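(* Let $M$ be a $3$-connected representable matroid. If $M$ is quasi-graphic, then $M$ is either a frame matroid or a lifted-graphic matroid.
   Context: For a graph $G$ and a vertex $v$, $\mathrm{loops}_G(v)$ denotes the set of loop-edges of $G$ at $v$. Graphs are finite and may have loops and parallel edges. For a set $X$ of edges, $G[X]$ is the subgraph of $G$ with edge-set $X$ and no isolated vertices. A graph $G$ is a framework for a matroid $M$ if (1) $E(G)=E(M)$; (2) $r_M(E(H))\le |V(H)|$ for each component $H$ of $G$; (3) for each vertex $v$ of $G$, $\mathrm{cl}_M(E(G-v))\subseteq E(G-v)\cup \mathrm{loops}_G(v)$; and (4) for each circuit $C$ of $M$, the subgraph $G[C]$ has at most two components. A matroid is quasi-graphic if it has a framework. A framed matroid is a pair $(M,V)$ where $M$ is a matroid, $V$ is a basis of $M$, and each element of $M$ is spanned by a subset of $V$ with at most two elements; $M$ is a frame matroid if there is a framed matroid $(M',V)$ with $M=M'\setminus V$. A matroid $M$ is lifted-graphic if there is a matroid $M'$ and $e\in E(M')$ with $M'\setminus e=M$ and $M'/e$ graphic. Representable means representable over some field. *)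

theory Defs
  imports Main
begin

section \<open>Matroids\<close>

text \<open>All matroids are finite. Independent sets are subsets of the ground set, so two matroids are
  the same exactly if the records are equal.\<close>

record 'e matroid =
  ground :: "'e set"
  indep :: "'e set \<Rightarrow> bool"

definition matroid :: "'e matroid \<Rightarrow> bool" where
  "matroid M \<longleftrightarrow>
     finite (ground M) \<and>
     (\<forall>X. indep M X \<longrightarrow> X \<subseteq> ground M) \<and>
     indep M {} \<and>
     (\<forall>X Y. indep M Y \<and> X \<subseteq> Y \<longrightarrow> indep M X) \<and>
     (\<forall>X Y. indep M X \<and> indep M Y \<and> card X < card Y \<longrightarrow> (\<exists>y\<in>Y - X. indep M (insert y X)))"

definition rank :: "'e matroid \<Rightarrow> 'e set \<Rightarrow> nat" where
  "rank M X = Max {card I |I. I \<subseteq> X \<and> indep M I}"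

definition cl :: "'e matroid \<Rightarrow> 'e set \<Rightarrow> 'e set" where
  "cl M X = {e \<in> ground M. rank M (insert e X) = rank M X}"

definition basis :: "'e matroid \<Rightarrow> 'e set \<Rightarrow> bool" where
  "basis M B \<longleftrightarrow> indep M B \<and> (\<forall>X. indep M X \<and> B \<subseteq> X \<longrightarrow> X = B)"

definition circuit :: "'e matroid \<Rightarrow> 'e set \<Rightarrow> bool" where
  "circuit M C \<longleftrightarrow> C \<subseteq> ground M \<and> \<not> indep M C \<and> (\<forall>X. X \<subset> C \<longrightarrow> indep M X)"

definition delete :: "'e matroid \<Rightarrow> 'e set \<Rightarrow> 'e matroid" where
  "delete M T = \<lparr>ground = ground M - T, indep = (\<lambda>X. indep M X \<and> X \<inter> T = {})\<rparr>"

text \<open>The rank function of the contraction sends \<open>X\<close> to \<open>rank M (X \<union> T) - rank M T\<close>.\<close>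

definition contract :: "'e matroid \<Rightarrow> 'e set \<Rightarrow> 'e matroid" where
  "contract M T =
     \<lparr>ground = ground M - T,
      indep = (\<lambda>X. X \<subseteq> ground M - T \<and> rank M (X \<union> T) = card X + rank M T)\<rparr>"

text \<open>Used only for injective relabellings.\<close>

definition relabel :: "('e \<Rightarrow> 'f) \<Rightarrow> 'e matroid \<Rightarrow> 'f matroid" where
  "relabel f M = \<lparr>ground = f ` ground M, indep = (\<lambda>X. \<exists>Y. indep M Y \<and> X = f ` Y)\<rparr>"

definition separation :: "nat \<Rightarrow> 'e matroid \<Rightarrow> 'e set \<Rightarrow> 'e set \<Rightarrow> bool" where
  "separation k M A B \<longleftrightarrow>
     A \<union> B = ground M \<and> A \<inter> B = {} \<and> k \<le> card A \<and> k \<le> card B \<and>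
     rank M A + rank M B < rank M (ground M) + k"

text \<open>Tutte connectivity of matroids.\<close>

definition n_connected :: "nat \<Rightarrow> 'e matroid \<Rightarrow> bool" where
  "n_connected n M \<longleftrightarrow> (\<forall>k A B. 1 \<le> k \<and> k < n \<longrightarrow> \<not> separation k M A B)"

text \<open>\<open>A\<close> is a matrix with \<open>m\<close> rows whose columns are indexed by the elements of \<open>M\<close>; a set is
  independent if the corresponding family of columns is linearly independent (so equal columns
  are dependent). A hypothesis \<open>representable_over TYPE('k) M\<close> with a type variable \<open>'k\<close> of class
  \<open>field\<close> expresses representability over some field.\<close>

definition representable_over :: "'k::field itself \<Rightarrow> 'e matroid \<Rightarrow> bool" where
  "representable_over K M \<longleftrightarrow>
     (\<exists>(m::nat) (A :: nat \<Rightarrow> 'e \<Rightarrow> 'k). \<forall>X\<subseteq>ground M.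
        indep M X \<longleftrightarrow>
        (\<forall>c. (\<forall>i<m. (\<Sum>e\<in>X. c e * A i e) = 0) \<longrightarrow> (\<forall>e\<in>X. c e = 0)))"


section \<open>Graphs with loops and parallel edges\<close>

text \<open>The set \<open>ends G e\<close> consists of the ends of \<open>e\<close>; it is a singleton exactly if \<open>e\<close> is a loop.\<close>

record ('v, 'e) graph =
  verts :: "'v set"
  edges :: "'e set"
  ends :: "'e \<Rightarrow> 'v set"

definition graph :: "('v, 'e) graph \<Rightarrow> bool" where
  "graph G \<longleftrightarrow> finite (verts G) \<and> finite (edges G) \<and>
     (\<forall>e\<in>edges G. ends G e \<subseteq> verts G \<and> (card (ends G e) = 1 \<or> card (ends G e) = 2))"

definition loops :: "('v, 'e) graph \<Rightarrow> 'v \<Rightarrow> 'e set" where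
  "loops G v = {e \<in> edges G. ends G e = {v}}"

definition induced :: "('v, 'e) graph \<Rightarrow> 'v set \<Rightarrow> ('v, 'e) graph" where
  "induced G W = \<lparr>verts = W, edges = {e \<in> edges G. ends G e \<subseteq> W}, ends = ends G\<rparr>"

definition delete_vertex :: "('v, 'e) graph \<Rightarrow> 'v \<Rightarrow> ('v, 'e) graph" where
  "delete_vertex G v = induced G (verts G - {v})"

definition edge_subgraph :: "('v, 'e) graph \<Rightarrow> 'e set \<Rightarrow> ('v, 'e) graph" where
  "edge_subgraph G X = \<lparr>verts = \<Union> (ends G ` X), edges = X, ends = ends G\<rparr>"

definition adjacency :: "('v, 'e) graph \<Rightarrow> ('v \<times> 'v) set" where
  "adjacency G = {(u, v). \<exists>e\<in>edges G. ends G e = {u, v}}"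

definition connectedness :: "('v, 'e) graph \<Rightarrow> ('v \<times> 'v) set" where
  "connectedness G = {(u, v). u \<in> verts G \<and> v \<in> verts G \<and> (u, v) \<in> (adjacency G)\<^sup>*}"

definition components :: "('v, 'e) graph \<Rightarrow> ('v, 'e) graph set" where
  "components G = induced G ` (verts G // connectedness G)"

text \<open>\<open>C\<close> is the edge set of a cycle with consecutive vertices \<open>vs\<close> and consecutive edges \<open>es\<close>.
  Loops are the cycles of length one and pairs of parallel edges the cycles of length two.\<close>

definition cycle :: "('v, 'e) graph \<Rightarrow> 'e set \<Rightarrow> bool" where
  "cycle G C \<longleftrightarrow> C \<subseteq> edges G \<and>
     (\<exists>vs es. es \<noteq> [] \<and> length vs = length es \<and> distinct vs \<and> distinct es \<and> C = set es \<and>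
        (\<forall>i<length es. ends G (es ! i) = {vs ! i, vs ! (Suc i mod length es)}))"

definition cycle_matroid :: "('v, 'e) graph \<Rightarrow> 'e matroid" where
  "cycle_matroid G =
     \<lparr>ground = edges G, indep = (\<lambda>X. X \<subseteq> edges G \<and> \<not> (\<exists>C\<subseteq>X. cycle G C))\<rparr>"

text \<open>Here and below vertices are natural numbers, which covers all finite graphs up to renaming
  of the vertices.\<close>

definition graphic :: "'e matroid \<Rightarrow> bool" where
  "graphic M \<longleftrightarrow> (\<exists>G :: (nat, 'e) graph. graph G \<and> cycle_matroid G = M)"


section \<open>Quasi-graphic, frame and lifted-graphic matroids\<close>

definition framework :: "('v, 'e) graph \<Rightarrow> 'e matroid \<Rightarrow> bool" where
  "framework G M \<longleftrightarrow> graph G \<and>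
     edges G = ground M \<and>
     (\<forall>H\<in>components G. rank M (edges H) \<le> card (verts H)) \<and>
     (\<forall>v\<in>verts G. cl M (edges (delete_vertex G v)) \<subseteq> edges (delete_vertex G v) \<union> loops G v) \<and>
     (\<forall>C. circuit M C \<longrightarrow> card (components (edge_subgraph G C)) \<le> 2)"

definition quasi_graphic :: "'e matroid \<Rightarrow> bool" where
  "quasi_graphic M \<longleftrightarrow> (\<exists>G :: (nat, 'e) graph. framework G M)"

definition framed_matroid :: "'e matroid \<Rightarrow> 'e set \<Rightarrow> bool" where
  "framed_matroid M V \<longleftrightarrow> matroid M \<and> basis M V \<and>
     (\<forall>e\<in>ground M. \<exists>S\<subseteq>V. card S \<le> 2 \<and> e \<in> cl M S)"

text \<open>The extending matroid \<open>M'\<close> may need more elements than the type \<open>'e\<close> has. It therefore lives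
  on \<open>'e + nat\<close>, where \<open>M\<close> is identified with its copy under \<open>Inl\<close> and where there is room for
  any finite number of new elements.\<close>

definition frame_matroid :: "'e matroid \<Rightarrow> bool" where
  "frame_matroid M \<longleftrightarrow>
     (\<exists>(M' :: ('e + nat) matroid) V. framed_matroid M' V \<and> delete M' V = relabel Inl M)"

definition lifted_graphic :: "'e matroid \<Rightarrow> bool" where
  "lifted_graphic M \<longleftrightarrow>
     (\<exists>(M' :: ('e + nat) matroid) e. matroid M' \<and> e \<in> ground M' \<and>
        delete M' {e} = relabel Inl M \<and> graphic (contract M' {e}))"

end

(*
  Represent M by vectors phi(e) over an infinite field. Condition (3) on the framework G yields for
  each vertex v a linear functional that vanishes on the edges avoiding v and on no non-loop edge
  at v. Together they form a linear map T that turns phi into a family T(phi(e)) supported on the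
  ends of e. If T preserves independence, then T(phi) represents M and, after adding the unit
  vectors, exhibits M as a frame matroid. Otherwise the connectivity of M and conditions (2), (4)
  show that a forest of G together with one more element spans M. As T is injective on the span of
  a forest, its kernel is a line, and the family T(phi) lies in the span of its members in a
  spanning forest; so it satisfies a linear relation with nonzero coefficients at all vertices and
  represents the cycle matroid of G. Adding a vector that spans the kernel of T gives the lift.
*)
theory Submission
  imports Defs "HOL-Library.Function_Algebras"
    "HOL-Computational_Algebra.Formal_Laurent_Series"
begin

section \<open>Matroids represented by families of vectors\<close>

text \<open>The map \<open>T\<close> can only lose independence: every relation among the vectors of
  M survives it, and a new relation means that its kernel meets their span. In that case the task is
  to show that the kernel is no larger than a line. Since \<open>T\<close> is injective on the span
  of a forest, it suffices to span M by a forest and one element. Rank alone does not give this: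
  condition (2) bounds each component separately and leaves room for one extra element per
  component; condition (4) and connectivity tie these extra elements together.

  The field is made infinite because the functional at a vertex has to be nonzero at all links there
  simultaneously, and over a small field there may be no such functional. Laurent series provide an
  infinite extension of every field.

  A relation with coefficients \<open>p v\<close> makes the family graphic for the following reason:
  after row \<open>v\<close> is multiplied by \<open>p v\<close>, the column of a link is a multiple
  of a difference of two unit vectors and the column of a loop is zero, as in the signed incidence
  matrix of a graph.\<close>

locale vector_family = vs: vector_space scale
  for scale :: "'k::field \<Rightarrow> 'b::ab_group_add \<Rightarrow> 'b"
begin

text \<open>Independence concerns the elements, not the set of their vectors. Without injectivity
  two parallel elements with the same vector would count as independent.\<close>

definition lin_indep :: "('i \<Rightarrow> 'b) \<Rightarrow> 'i set \<Rightarrow> bool" where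
  "lin_indep \<phi> X \<longleftrightarrow> inj_on \<phi> X \<and> vs.independent (\<phi> ` X)"

lemma lin_indep_iff:
  fixes \<phi> :: "'i \<Rightarrow> 'b"
  assumes "finite X"
  shows "lin_indep \<phi> X \<longleftrightarrow>
    (\<forall>c. (\<Sum>x\<in>X. scale (c x) (\<phi> x)) = 0 \<longrightarrow> (\<forall>x\<in>X. c x = 0))"
proof
  assume L: "lin_indep \<phi> X"
  show "\<forall>c. (\<Sum>x\<in>X. scale (c x) (\<phi> x)) = 0 \<longrightarrow> (\<forall>x\<in>X. c x = 0)"
  proof (intro allI impI)
    fix c assume c: "(\<Sum>x\<in>X. scale (c x) (\<phi> x)) = 0"
    have inj: "inj_on \<phi> X" and ind: "vs.independent (\<phi> ` X)"
      using L by (auto simp: lin_indep_def)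
    have "(\<Sum>v\<in>\<phi> ` X. scale (c (the_inv_into X \<phi> v)) v) = (\<Sum>x\<in>X. scale (c x) (\<phi> x))"
      by (simp add: sum.reindex[OF inj] the_inv_into_f_f[OF inj])
    then have "\<forall>v\<in>\<phi> ` X. c (the_inv_into X \<phi> v) = 0"
      using ind c assms by (auto simp: vs.dependent_finite)
    then show "\<forall>x\<in>X. c x = 0"
      by (simp add: the_inv_into_f_f[OF inj])
  qed
next
  assume R: "\<forall>c. (\<Sum>x\<in>X. scale (c x) (\<phi> x)) = 0 \<longrightarrow> (\<forall>x\<in>X. c x = 0)"
  have inj: "inj_on \<phi> X"
  proof (rule inj_onI, rule ccontr)
    fix x y assume xy: "x \<in> X" "y \<in> X" "\<phi> x = \<phi> y" "x \<noteq> y"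
    define c where "c z = (if z = x then 1 else if z = y then - 1 else 0 :: 'k)" for z
    have "(\<Sum>z\<in>X. scale (c z) (\<phi> z)) = (\<Sum>z\<in>{x, y}. scale (c z) (\<phi> z))"
      by (rule sum.mono_neutral_right) (use xy assms in \<open>auto simp: c_def\<close>)
    also have "\<dots> = 0"
      using xy by (auto simp: c_def)
    finally have "c x = 0"
      using R xy by blast
    then show False
      by (simp add: c_def)
  qed
  moreover have "vs.independent (\<phi> ` X)"
  proof
    assume "vs.dependent (\<phi> ` X)"
    then obtain u v where u: "(\<Sum>v\<in>\<phi> ` X. scale (u v) v) = 0" "v \<in> \<phi> ` X" "u v \<noteq> 0"
      using assms vs.dependent_finite[of "\<phi> ` X"] by auto
    then have "(\<Sum>x\<in>X. scale (u (\<phi> x)) (\<phi> x)) = 0"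
      by (simp add: sum.reindex[OF inj])
    with R have "\<forall>x\<in>X. u (\<phi> x) = 0"
      by (auto dest: spec[of _ "\<lambda>x. u (\<phi> x)"])
    with u show False
      by auto
  qed
  ultimately show "lin_indep \<phi> X"
    by (simp add: lin_indep_def)
qed

lemma span_image_base: "x \<in> X \<Longrightarrow> \<phi> x \<in> vs.span (\<phi> ` X)"
  by (simp add: vs.span_base)

lemma span_image_mono: "X \<subseteq> Y \<Longrightarrow> vs.span (\<phi> ` X) \<subseteq> vs.span (\<phi> ` Y)"
  by (intro vs.span_mono image_mono)

lemma lin_indep_empty [simp]: "lin_indep \<phi> {}"
  by (simp add: lin_indep_def vs.independent_empty)

lemma lin_indep_mono: "lin_indep \<phi> X \<Longrightarrow> Y \<subseteq> X \<Longrightarrow> lin_indep \<phi> Y"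
  unfolding lin_indep_def by (meson image_mono inj_on_subset vs.independent_mono)

lemma lin_indep_insert:
  "x \<notin> X \<Longrightarrow> lin_indep \<phi> (insert x X) \<longleftrightarrow> lin_indep \<phi> X \<and> \<phi> x \<notin> vs.span (\<phi> ` X)"
  unfolding lin_indep_def by (auto simp: vs.independent_insert vs.span_base)

lemma lin_indep_card_le:
  assumes "lin_indep \<phi> I" "finite S" "\<phi> ` I \<subseteq> vs.span (\<psi> ` S)"
  shows "card I \<le> card S"
proof -
  have "card (\<phi> ` I) \<le> card (\<psi> ` S)"
    using assms vs.independent_span_bound unfolding lin_indep_def by blast
  then show ?thesis
    using assms card_image_le[of S \<psi>] by (auto simp: lin_indep_def card_image)
qed

lemma lin_indep_extend:
  assumes "finite X" "I \<subseteq> X" "lin_indep \<phi> I"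
  obtains J where "I \<subseteq> J" "J \<subseteq> X" "lin_indep \<phi> J" "\<phi> ` X \<subseteq> vs.span (\<phi> ` J)"
proof -
  let ?P = "\<lambda>J. I \<subseteq> J \<and> J \<subseteq> X \<and> lin_indep \<phi> J"
  have "finite {J. ?P J}"
    by (rule finite_subset[of _ "Pow X"]) (use assms in auto)
  moreover have "{J. ?P J} \<noteq> {}"
    using assms by auto
  ultimately obtain J where J: "?P J" and max: "\<And>K. ?P K \<Longrightarrow> J \<subseteq> K \<Longrightarrow> K = J"
    by (metis (no_types, lifting) finite_has_maximal mem_Collect_eq)
  have "\<phi> x \<in> vs.span (\<phi> ` J)" if "x \<in> X" for x
  proof (rule ccontr)
    assume x: "\<phi> x \<notin> vs.span (\<phi> ` J)"
    then have "x \<notin> J"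
      by (auto simp: vs.span_base)
    moreover have "?P (insert x J)"
      using J x that \<open>x \<notin> J\<close> by (auto simp: lin_indep_insert)
    ultimately show False
      using max[of "insert x J"] by auto
  qed
  with that[of J] J show thesis
    by auto
qed

definition vec_matroid :: "'i set \<Rightarrow> ('i \<Rightarrow> 'b) \<Rightarrow> 'i matroid" where
  "vec_matroid E \<phi> = \<lparr>ground = E, indep = (\<lambda>X. X \<subseteq> E \<and> lin_indep \<phi> X)\<rparr>"

lemma ground_vec_matroid [simp]: "ground (vec_matroid E \<phi>) = E"
  by (simp add: vec_matroid_def)

lemma indep_vec_matroid [simp]: "indep (vec_matroid E \<phi>) X \<longleftrightarrow> X \<subseteq> E \<and> lin_indep \<phi> X"
  by (simp add: vec_matroid_def)

lemma vec_matroid_cong: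
  assumes "\<And>X. X \<subseteq> E \<Longrightarrow> lin_indep \<phi> X \<longleftrightarrow> lin_indep \<psi> X"
  shows "vec_matroid E \<phi> = vec_matroid E \<psi>"
  using assms by (auto simp: vec_matroid_def)

text \<open>Augmentation is the exchange bound: if the span of the smaller family contained all
  vectors of the larger one, the larger one would have at most as many elements.\<close>

lemma matroid_vec_matroid:
  assumes "finite E"
  shows "matroid (vec_matroid E \<phi>)"
  unfolding matroid_def
proof (intro conjI allI impI)
  fix X Y
  assume *: "indep (vec_matroid E \<phi>) X \<and> indep (vec_matroid E \<phi>) Y \<and> card X < card Y"
  then have "finite X"
    using assms finite_subset by auto
  then obtain y where y: "y \<in> Y" "\<phi> y \<notin> vs.span (\<phi> ` X)"
    using * lin_indep_card_le[of \<phi> Y X \<phi>] by fastforce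
  then have "y \<in> Y - X"
    using span_image_base[of y X \<phi>] by auto
  with y show "\<exists>y\<in>Y - X. indep (vec_matroid E \<phi>) (insert y X)"
    using * lin_indep_insert[of y X \<phi>] by (intro bexI[of _ y]) auto
qed (use assms in \<open>auto intro: lin_indep_mono\<close>)

end

section \<open>Rank and circuits, for arbitrary matroids and for families of vectors\<close>

lemma card_le_rank:
  assumes "matroid M" "indep M I" "I \<subseteq> X"
  shows "card I \<le> rank M X"
proof -
  have "{card I |I. I \<subseteq> X \<and> indep M I} \<subseteq> card ` Pow (ground M)"
    using assms by (auto simp: matroid_def)
  then have "finite {card I |I. I \<subseteq> X \<and> indep M I}"
    using assms by (meson finite_Pow_iff finite_imageI finite_subset matroid_def)
  then show ?thesis
    unfolding rank_def using assms by (intro Max_ge) auto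
qed

lemma obtain_rank:
  assumes "matroid M"
  obtains I where "I \<subseteq> X" "indep M I" "card I = rank M X"
proof -
  have "{card I |I. I \<subseteq> X \<and> indep M I} \<subseteq> card ` Pow (ground M)"
    using assms by (auto simp: matroid_def)
  then have "finite {card I |I. I \<subseteq> X \<and> indep M I}"
    using assms by (meson finite_Pow_iff finite_imageI finite_subset matroid_def)
  moreover have "{card I |I. I \<subseteq> X \<and> indep M I} \<noteq> {}"
    using assms by (auto simp: matroid_def)
  ultimately have "rank M X \<in> {card I |I. I \<subseteq> X \<and> indep M I}"
    unfolding rank_def by (rule Max_in)
  with that show thesis
    by auto
qed

lemma obtain_circuit:
  assumes "matroid M" "X \<subseteq> ground M" "\<not> indep M X"
  obtains C where "C \<subseteq> X" "circuit M C"
proof -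
  have fin: "finite X"
    using assms finite_subset by (auto simp: matroid_def)
  have "finite {C. C \<subseteq> X \<and> \<not> indep M C}"
    by (rule finite_subset[of _ "Pow X"]) (use fin in auto)
  moreover have "{C. C \<subseteq> X \<and> \<not> indep M C} \<noteq> {}"
    using assms by auto
  ultimately obtain C where C: "C \<subseteq> X" "\<not> indep M C"
    and min: "\<And>D. D \<subseteq> X \<Longrightarrow> \<not> indep M D \<Longrightarrow> D \<subseteq> C \<Longrightarrow> D = C"
    by (metis (no_types, lifting) finite_has_minimal mem_Collect_eq)
  have "circuit M C"
    unfolding circuit_def using C min assms by blast
  with that C show thesis
    by blast
qed

context vector_family
begin

lemma rank_vec_matroid_le:
  assumes "finite E" "finite S" "\<phi> ` X \<subseteq> vs.span (\<phi> ` S)"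
  shows "rank (vec_matroid E \<phi>) X \<le> card S"
proof -
  obtain I where "I \<subseteq> X" "indep (vec_matroid E \<phi>) I" "card I = rank (vec_matroid E \<phi>) X"
    using obtain_rank[OF matroid_vec_matroid[OF assms(1)]] by metis
  then show ?thesis
    using lin_indep_card_le[of \<phi> I S \<phi>] assms by auto
qed

text \<open>Turns condition (3) of a framework into linear algebra: an element outside the closure
  has a vector outside the span, so a linear functional separates it from the span.\<close>

lemma span_imp_mem_cl:
  assumes "finite E" "X \<subseteq> E" "e \<in> E" "\<phi> e \<in> vs.span (\<phi> ` X)"
  shows "e \<in> cl (vec_matroid E \<phi>) X"
proof -
  let ?M = "vec_matroid E \<phi>"
  have M: "matroid ?M" and "finite X"
    using assms by (auto simp: matroid_vec_matroid finite_subset)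
  then obtain J where J: "J \<subseteq> X" "lin_indep \<phi> J" "\<phi> ` X \<subseteq> vs.span (\<phi> ` J)"
    using lin_indep_extend[of X "{}" \<phi>] by auto
  have "vs.span (\<phi> ` X) \<subseteq> vs.span (\<phi> ` J)"
    using J by (simp add: vs.span_minimal)
  then have "rank ?M (insert e X) \<le> card J"
    using assms J \<open>finite X\<close> by (intro rank_vec_matroid_le) (auto intro: finite_subset)
  also have "card J \<le> rank ?M X"
    using assms J M by (intro card_le_rank) auto
  finally have "rank ?M (insert e X) \<le> rank ?M X" .
  moreover have "rank ?M X \<le> rank ?M (insert e X)"
    using obtain_rank[OF M, of X] card_le_rank[OF M] by (metis subset_insertI2)
  ultimately show ?thesis
    using assms by (simp add: cl_def)
qed

lemma circuit_vec_matroid_span: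
  assumes "circuit (vec_matroid E \<phi>) C" "x \<in> C"
  shows "\<phi> x \<in> vs.span (\<phi> ` (C - {x}))"
proof (rule ccontr)
  assume "\<phi> x \<notin> vs.span (\<phi> ` (C - {x}))"
  moreover have "C - {x} \<subset> C" "C \<subseteq> E" "insert x (C - {x}) = C"
    using assms by (auto simp: circuit_def)
  ultimately show False
    using assms lin_indep_insert[of x "C - {x}" \<phi>] unfolding circuit_def by auto
qed

text \<open>A nontrivial relation that vanished somewhere on a circuit would be a relation on an
  independent set. Full support is what later makes the whole circuit, and not only a part of it,
  \<open>leafless\<close>.\<close>

lemma circuit_vec_matroid_support:
  assumes "finite E" "circuit (vec_matroid E \<phi>) C"
  obtains c where "\<And>x. x \<in> C \<Longrightarrow> c x \<noteq> 0" "(\<Sum>x\<in>C. scale (c x) (\<phi> x)) = 0"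
proof -
  have C: "C \<subseteq> E" "\<not> lin_indep \<phi> C" "\<And>X. X \<subset> C \<Longrightarrow> lin_indep \<phi> X"
    using assms by (auto simp: circuit_def)
  then have fin: "finite C"
    using assms finite_subset by auto
  then obtain c y where c: "(\<Sum>x\<in>C. scale (c x) (\<phi> x)) = 0" "y \<in> C" "c y \<noteq> 0"
    using C by (auto simp: lin_indep_iff)
  have "c x \<noteq> 0" if "x \<in> C" for x
  proof
    assume "c x = 0"
    then have "(\<Sum>z\<in>C - {x}. scale (c z) (\<phi> z)) = 0"
      using c(1) fin that by (simp add: sum.remove[of C x])
    moreover have "lin_indep \<phi> (C - {x})"
      by (rule C(3)) (use that in auto)
    ultimately have "\<forall>z\<in>C - {x}. c z = 0"
      using fin by (simp add: lin_indep_iff)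
    with c \<open>c x = 0\<close> show False
      by auto
  qed
  with c that show thesis
    by blast
qed

lemma obtain_circuit_through:
  assumes "finite E" "I \<subseteq> E" "lin_indep \<phi> I" "e \<in> E" "e \<notin> I" "\<phi> e \<in> vs.span (\<phi> ` I)"
  obtains C where "C \<subseteq> insert e I" "e \<in> C" "circuit (vec_matroid E \<phi>) C"
proof -
  have "\<not> lin_indep \<phi> (insert e I)"
    using assms by (simp add: lin_indep_insert)
  then obtain C where C: "C \<subseteq> insert e I" "circuit (vec_matroid E \<phi>) C"
    using obtain_circuit[OF matroid_vec_matroid[OF assms(1)], of "insert e I" \<phi>] assms by auto
  have "e \<in> C"
  proof (rule ccontr)
    assume "e \<notin> C"
    then have "C \<subseteq> I" using C by auto
    with C assms show False
      using lin_indep_mono unfolding circuit_def by fastforce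
  qed
  with C that show thesis by blast
qed

end

section \<open>Forests and cycles\<close>

text \<open>No end of a link in \<open>D\<close> has degree one in \<open>D\<close>, where a loop
  counts as a further edge at its vertex. Loops themselves are unconstrained, since a loop is
  already a cycle and may carry the value zero in an incidence family.\<close>

definition leafless :: "('v, 'e) graph \<Rightarrow> 'e set \<Rightarrow> bool" where
  "leafless G D \<longleftrightarrow>
    (\<forall>e\<in>D. \<forall>v\<in>ends G e. card (ends G e) = 2 \<longrightarrow> (\<exists>e'\<in>D - {e}. v \<in> ends G e'))"

lemma graph_ends_cases:
  assumes "graph G" "e \<in> edges G"
  obtains (loop) v where "ends G e = {v}" "v \<in> verts G"
  | (link) u v where "ends G e = {u, v}" "u \<noteq> v" "u \<in> verts G" "v \<in> verts G"
proof -
  have "ends G e \<subseteq> verts G" "card (ends G e) = 1 \<or> card (ends G e) = 2"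
    using assms by (auto simp: graph_def)
  then show thesis
    using loop link by (auto simp: card_1_singleton_iff card_2_iff)
qed

section \<open>Paths, and cycles in edge sets without leaves\<close>

definition path :: "('v, 'e) graph \<Rightarrow> 'v list \<Rightarrow> 'e list \<Rightarrow> bool" where
  "path G vs es \<longleftrightarrow> length vs = Suc (length es) \<and> distinct vs \<and> distinct es \<and>
     (\<forall>i<length es. ends G (es ! i) = {vs ! i, vs ! Suc i})"

lemma path_Cons:
  assumes "path G vs es" "ends G e = {w, hd vs}" "w \<notin> set vs"
  shows "path G (w # vs) (e # es)"
proof -
  have "e \<notin> set es"
  proof
    assume "e \<in> set es"
    then obtain i where i: "i < length es" "e = es ! i"
      by (auto simp: in_set_conv_nth)
    then have "w \<in> {vs ! i, vs ! Suc i}"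
      using assms by (auto simp: path_def)
    moreover have "vs ! i \<in> set vs" "vs ! Suc i \<in> set vs"
      using i assms by (auto simp: path_def)
    ultimately show False
      using assms by auto
  qed
  moreover have "ends G ((e # es) ! i) = {(w # vs) ! i, (w # vs) ! Suc i}"
    if "i < length (e # es)" for i
    using that assms by (cases i; cases vs) (auto simp: path_def)
  ultimately show ?thesis
    using assms by (auto simp: path_def)
qed

text \<open>For \<open>j = 1\<close> the closing edge could be the first edge of the path itself.
  Excluding this suffices, because by distinctness of the vertices no other edge of the path
  contains \<open>vs ! 0\<close>.\<close>

lemma path_closed_by_edge:
  assumes p: "path G vs es" and e: "ends G e = {vs ! j, vs ! 0}" "0 < j" "j < length vs"
    and ne: "e \<noteq> es ! 0" and sub: "set es \<subseteq> edges G" "e \<in> edges G"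
  shows "cycle G (set (take j es @ [e]))"
proof -
  let ?vs = "take (Suc j) vs" and ?es = "take j es @ [e]"
  have len: "length ?vs = length ?es" "length ?es = Suc j"
    using p e by (auto simp: path_def)
  have "e \<notin> set (take j es)"
  proof
    assume "e \<in> set (take j es)"
    then obtain i where i: "i < j" "i < length es" "e = es ! i"
      by (auto simp: in_set_conv_nth)
    then have "vs ! 0 \<in> {vs ! i, vs ! Suc i}"
      using p e by (auto simp: path_def)
    then have "i = 0"
      using p i by (auto simp: path_def nth_eq_iff_index_eq)
    with i ne show False by simp
  qed
  then have "distinct ?es" "distinct ?vs"
    using p by (auto simp: path_def)
  moreover have "ends G (?es ! i) = {?vs ! i, ?vs ! (Suc i mod length ?es)}"
    if "i < length ?es" for i
  proof (cases "i = j")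
    case True
    then show ?thesis
      using len e p by (auto simp: path_def nth_append)
  next
    case False
    then have "i < j" "i < length es"
      using that p e by (auto simp: path_def)
    then show ?thesis
      using len p by (auto simp: path_def nth_append)
  qed
  moreover have "set ?es \<subseteq> edges G"
    using sub by (auto dest: in_set_takeD)
  ultimately show ?thesis
    unfolding cycle_def using len(1) by (intro conjI exI[of _ ?vs] exI[of _ ?es]) auto
qed

text \<open>A loop is a cycle. Without loops, a longest path in \<open>D\<close> has a second edge
  of \<open>D\<close> at its first vertex; by maximality the other end of that edge is on the path,
  so it closes an initial segment to a cycle.\<close>

lemma leafless_contains_cycle:
  assumes G: "graph G" and D: "D \<subseteq> edges G" "D \<noteq> {}" and leafless: "leafless G D"
  obtains C where "C \<subseteq> D" "cycle G C"
proof (cases "\<exists>e\<in>D. card (ends G e) = 1")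
  case True
  then obtain e v where e: "e \<in> D" "ends G e = {v}"
    by (auto simp: card_1_singleton_iff)
  have "cycle G {e}"
    unfolding cycle_def using e D
    by (intro conjI exI[of _ "[v]"] exI[of _ "[e]"]) auto
  with e that show thesis
    by blast
next
  case False
  then have card2: "card (ends G e) = 2" "ends G e \<subseteq> verts G" if "e \<in> D" for e
    using that G D by (auto simp: graph_def)
  define P where "P n \<longleftrightarrow> (\<exists>vs es. path G vs es \<and> set es \<subseteq> D \<and> set vs \<subseteq> verts G \<and> length es = n)" for n
  have bound: "n \<le> card (verts G)" if "P n" for n
  proof -
    obtain vs es where "path G vs es" "set vs \<subseteq> verts G" "length es = n"
      using \<open>P n\<close> by (auto simp: P_def)
    moreover have "finite (verts G)"
      using G by (simp add: graph_def)
    ultimately show ?thesis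
      using card_mono[of "verts G" "set vs"] by (auto simp: path_def distinct_card)
  qed
  obtain e1 where "e1 \<in> D"
    using D by blast
  then obtain u v where uv: "ends G e1 = {u, v}" "u \<noteq> v"
    using card2(1) by (meson card_2_iff)
  then have "path G [u, v] [e1]"
    by (auto simp: path_def)
  then have "P 1"
    unfolding P_def using uv card2(2)[OF \<open>e1 \<in> D\<close>] \<open>e1 \<in> D\<close>
    by (intro exI[of _ "[u, v]"] exI[of _ "[e1]"]) auto
  then obtain n where n: "P n" and max: "\<And>m. P m \<Longrightarrow> m \<le> n"
    using bound GreatestI_nat[of P 1] Greatest_le_nat[of P] by blast
  then obtain vs es where p: "path G vs es" "set es \<subseteq> D" "set vs \<subseteq> verts G" "length es = n"
    by (auto simp: P_def)
  have "0 < length es"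
    using p max[OF \<open>P 1\<close>] by simp
  then have e0: "es ! 0 \<in> D" "vs ! 0 \<in> ends G (es ! 0)"
    using p by (auto simp: path_def)
  then obtain e where e: "e \<in> D" "e \<noteq> es ! 0" "vs ! 0 \<in> ends G e"
    using leafless card2 unfolding leafless_def by blast
  obtain w where w: "ends G e = {w, vs ! 0}" "w \<noteq> vs ! 0"
  proof -
    obtain x y where "ends G e = {x, y}" "x \<noteq> y"
      using card2(1)[OF e(1)] by (auto simp: card_2_iff)
    with e(3) that show thesis
      by (cases "vs ! 0 = x") (auto simp: insert_commute)
  qed
  have "vs \<noteq> []"
    using p by (auto simp: path_def)
  have "w \<in> set vs"
  proof (rule ccontr)
    assume "w \<notin> set vs"
    then have "path G (w # vs) (e # es)"
      using p w \<open>vs \<noteq> []\<close> by (intro path_Cons) (auto simp: hd_conv_nth)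
    then have "P (Suc n)"
      unfolding P_def using p e w card2(2)[OF e(1)]
      by (intro exI[of _ "w # vs"] exI[of _ "e # es"]) auto
    then show False
      using max by fastforce
  qed
  then obtain j where j: "j < length vs" "w = vs ! j"
    by (auto simp: in_set_conv_nth)
  with w have "0 < j"
    by (cases j) auto
  then have "cycle G (set (take j es @ [e]))"
    using p w j e D by (intro path_closed_by_edge[of G vs]) auto
  moreover have "set (take j es @ [e]) \<subseteq> D"
    using p e by (auto dest: in_set_takeD)
  ultimately show thesis
    using that by blast
qed

text \<open>Prepares a dimension count: as many vectors as coordinates become dependent as soon as
  they satisfy one common linear equation. Loops fit in as cycles with one vertex.\<close>

lemma cycle_card:
  assumes "cycle G C"
  obtains S where "finite S" "S \<noteq> {}" "card S = card C" "finite C" "\<And>e. e \<in> C \<Longrightarrow> ends G e \<subseteq> S"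
proof -
  obtain vs es where *: "es \<noteq> []" "length vs = length es" "distinct vs" "distinct es" "C = set es"
    "\<forall>i<length es. ends G (es ! i) = {vs ! i, vs ! (Suc i mod length es)}"
    using assms by (auto simp: cycle_def)
  have "ends G e \<subseteq> set vs" if e: "e \<in> C" for e
  proof -
    obtain i where i: "i < length es" "e = es ! i"
      using e * by (auto simp: in_set_conv_nth)
    then have "Suc i mod length es < length es"
      by (intro mod_less_divisor) auto
    then show ?thesis
      using i * by simp
  qed
  moreover have "vs \<noteq> []"
    using * by auto
  ultimately show thesis
    using that[of "set vs"] * by (auto simp: distinct_card)
qed

text \<open>Each step attaches a new leaf \<open>v\<close>, while \<open>u\<close> may be old or
  new. This order gives the inductions used below: the last edge cannot lie in a
  \<open>leafless\<close> set, and a value at \<open>v\<close> can be chosen without affecting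
  earlier edges.\<close>

inductive forest :: "('v, 'e) graph \<Rightarrow> 'e set \<Rightarrow> bool" for G where
  empty: "forest G {}"
| insert: "forest G X \<Longrightarrow> ends G e = {u, v} \<Longrightarrow> u \<noteq> v \<Longrightarrow> v \<notin> \<Union> (ends G ` X) \<Longrightarrow> forest G (insert e X)"

text \<open>Among the edges of \<open>D\<close>, the one attached last has an end that no other edge
  of \<open>D\<close> meets.\<close>

lemma forest_leafless:
  assumes "forest G F" "D \<subseteq> F" "leafless G D"
  shows "D = {}"
  using assms
proof (induction arbitrary: D)
  case (insert X e u v)
  have "e \<notin> D"
  proof
    assume "e \<in> D"
    moreover have "card (ends G e) = 2" "v \<in> ends G e"
      using insert by auto
    ultimately obtain e' where "e' \<in> D - {e}" "v \<in> ends G e'"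
      using insert.prems unfolding leafless_def by blast
    with insert show False by auto
  qed
  with insert show ?case by auto
qed auto

lemma forest_Un:
  assumes "forest G Y" "forest G X" "\<Union> (ends G ` X) \<inter> \<Union> (ends G ` Y) = {}"
  shows "forest G (X \<union> Y)"
  using assms
proof (induction)
  case (insert Y e u v)
  then have "forest G (insert e (X \<union> Y))"
    by (intro forest.insert) auto
  then show ?case by simp
qed auto

section \<open>Components\<close>

lemma equiv_connectedness: "equiv (verts G) (connectedness G)"
proof (rule equivI)
  have "sym (adjacency G)"
    by (auto simp: sym_def adjacency_def insert_commute)
  then have "sym ((adjacency G)\<^sup>*)"
    by (rule sym_rtrancl)
  then show "sym (connectedness G)"
    by (auto simp: sym_def connectedness_def)
qed (auto simp: connectedness_def refl_on_def trans_def)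

lemma connectedness_class_of_edge:
  assumes "graph G" "e \<in> edges G"
  obtains W where "W \<in> verts G // connectedness G" "e \<in> edges (induced G W)"
proof -
  have "\<exists>v. v \<in> verts G \<and> ends G e \<subseteq> connectedness G `` {v}"
    using assms
  proof (cases rule: graph_ends_cases)
    case (link u v)
    then have "(u, v) \<in> adjacency G"
      using assms by (auto simp: adjacency_def)
    with link show ?thesis
      by (intro exI[of _ u]) (auto simp: connectedness_def)
  qed (auto simp: connectedness_def)
  then obtain v where "v \<in> verts G" "ends G e \<subseteq> connectedness G `` {v}"
    by blast
  with that[of "connectedness G `` {v}"] assms show thesis
    by (auto simp: induced_def intro: quotientI)
qed

lemma connectedness_class_unique:
  assumes "graph G" "W \<in> verts G // connectedness G" "W' \<in> verts G // connectedness G"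
    "e \<in> edges (induced G W)" "e \<in> edges (induced G W')"
  shows "W = W'"
proof -
  have "e \<in> edges G" "ends G e \<subseteq> W \<inter> W'"
    using assms by (auto simp: induced_def)
  moreover have "ends G e \<noteq> {}"
    using graph_ends_cases[OF assms(1) \<open>e \<in> edges G\<close>] by (metis insert_not_empty)
  ultimately show ?thesis
    using quotient_disj[OF equiv_connectedness assms(2,3)] by blast
qed

text \<open>An edge that shares a vertex with \<open>e\<close> lies in the component of
  \<open>e\<close>, so the witnesses for \<open>leafless\<close> survive the restriction.\<close>

lemma leafless_Int_class:
  assumes G: "graph G" and D: "D \<subseteq> edges G" "leafless G D" and W: "W \<in> verts G // connectedness G"
  shows "leafless G (D \<inter> edges (induced G W))"
  unfolding leafless_def
proof (intro ballI impI)
  fix e v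
  assume e: "e \<in> D \<inter> edges (induced G W)" "v \<in> ends G e" "card (ends G e) = 2"
  then obtain e' where e': "e' \<in> D - {e}" "v \<in> ends G e'"
    using D unfolding leafless_def by blast
  then obtain W' where W': "W' \<in> verts G // connectedness G" "e' \<in> edges (induced G W')"
    using connectedness_class_of_edge[OF G, of e'] D by blast
  then have "v \<in> W" "v \<in> W'"
    using e e' by (auto simp: induced_def)
  then have "W' = W"
    using quotient_disj[OF equiv_connectedness W'(1) W] by blast
  with e' W' show "\<exists>e'\<in>D \<inter> edges (induced G W) - {e}. v \<in> ends G e'"
    by blast
qed

text \<open>Connectedness in the subgraph refines connectedness in \<open>G\<close>, so each of the
  three classes contains a nonempty class of the subgraph. Distinct vertex sets give distinct
  induced graphs.\<close>

lemma components_ge_3: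
  assumes G: "graph G" and X: "X \<subseteq> edges G"
    and W: "W\<^sub>1 \<in> verts G // connectedness G" "W\<^sub>2 \<in> verts G // connectedness G"
      "W\<^sub>3 \<in> verts G // connectedness G" "W\<^sub>1 \<noteq> W\<^sub>2" "W\<^sub>1 \<noteq> W\<^sub>3" "W\<^sub>2 \<noteq> W\<^sub>3"
    and meet: "X \<inter> edges (induced G W\<^sub>1) \<noteq> {}" "X \<inter> edges (induced G W\<^sub>2) \<noteq> {}"
      "X \<inter> edges (induced G W\<^sub>3) \<noteq> {}"
  shows "3 \<le> card (components (edge_subgraph G X))"
proof -
  let ?H = "edge_subgraph G X"
  have "verts ?H \<subseteq> verts G"
    using G X by (auto simp: edge_subgraph_def graph_def)
  moreover have "adjacency ?H \<subseteq> adjacency G"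
    using X by (auto simp: edge_subgraph_def adjacency_def)
  ultimately have sub: "connectedness ?H \<subseteq> connectedness G"
    using rtrancl_mono[of "adjacency ?H" "adjacency G"] by (auto simp: connectedness_def)
  have "finite (verts ?H)"
    using G \<open>verts ?H \<subseteq> verts G\<close> finite_subset by (auto simp: graph_def)
  \<comment> \<open>Finiteness matters, since the cardinality of an infinite set is 0 by
    convention.\<close>
  then have fin: "finite (components ?H)"
    unfolding components_def
    by (intro finite_imageI finite_quotient[of _ "connectedness ?H"])
      (auto simp: connectedness_def)
  have ex: "\<exists>K. K \<noteq> {} \<and> K \<subseteq> W \<and> induced ?H K \<in> components ?H"
    if W: "W \<in> verts G // connectedness G" and meet: "X \<inter> edges (induced G W) \<noteq> {}" for W
  proof -
    obtain e where e: "e \<in> X" "e \<in> edges G" "ends G e \<subseteq> W"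
      using meet unfolding induced_def by auto
    then obtain v where v: "v \<in> ends G e"
      using graph_ends_cases[OF G] by (metis insertI1)
    have vH: "v \<in> verts ?H"
      using e v by (auto simp: edge_subgraph_def)
    have "connectedness ?H `` {v} \<subseteq> connectedness G `` {v}"
      using sub by auto
    also have "\<dots> \<subseteq> W"
      using e v in_quotient_imp_closed[OF equiv_connectedness W] by auto
    finally show ?thesis
      using vH equiv_class_self[OF equiv_connectedness vH]
      by (intro exI[of _ "connectedness ?H `` {v}"]) (auto simp: components_def quotientI)
  qed
  obtain K\<^sub>1 where K1: "K\<^sub>1 \<noteq> {}" "K\<^sub>1 \<subseteq> W\<^sub>1" "induced ?H K\<^sub>1 \<in> components ?H"
    using ex[OF W(1) meet(1)] by blast
  obtain K\<^sub>2 where K2: "K\<^sub>2 \<noteq> {}" "K\<^sub>2 \<subseteq> W\<^sub>2" "induced ?H K\<^sub>2 \<in> components ?H"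
    using ex[OF W(2) meet(2)] by blast
  obtain K\<^sub>3 where K3: "K\<^sub>3 \<noteq> {}" "K\<^sub>3 \<subseteq> W\<^sub>3" "induced ?H K\<^sub>3 \<in> components ?H"
    using ex[OF W(3) meet(3)] by blast
  have "K\<^sub>1 \<noteq> K\<^sub>2" "K\<^sub>1 \<noteq> K\<^sub>3" "K\<^sub>2 \<noteq> K\<^sub>3"
    using K1 K2 K3 W quotient_disj[OF equiv_connectedness, of _ G] by blast+
  then have "card {induced ?H K\<^sub>1, induced ?H K\<^sub>2, induced ?H K\<^sub>3} = 3"
    by (auto simp: induced_def)
  moreover have "{induced ?H K\<^sub>1, induced ?H K\<^sub>2, induced ?H K\<^sub>3} \<subseteq> components ?H"
    using K1 K2 K3 by auto
  ultimately show ?thesis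
    using card_mono[OF fin] by metis
qed

text \<open>A tree on a largest possible set \<open>S\<close> of vertices covers the class:
  otherwise some edge leaves \<open>S\<close> and attaches one more leaf. The predicate counts
  vertices so that a greatest number can be taken.\<close>

lemma exists_spanning_tree_of_class:
  assumes G: "graph G" and W: "W \<in> verts G // connectedness G"
  obtains F where "F \<subseteq> edges (induced G W)" "forest G F" "Suc (card F) = card W"
proof -
  have WV: "W \<subseteq> verts G"
    using in_quotient_imp_subset[OF equiv_connectedness W] .
  then have finW: "finite W"
    using G finite_subset by (auto simp: graph_def)
  obtain w where w: "w \<in> W"
    using in_quotient_imp_non_empty[OF equiv_connectedness W] by blast
  define P where "P n \<longleftrightarrow> (\<exists>S F. w \<in> S \<and> S \<subseteq> W \<and> F \<subseteq> edges (induced G S) \<and> forest G F \<and>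
    Suc (card F) = card S \<and> card S = n)" for n
  have "P 1"
    unfolding P_def using w by (intro exI[of _ "{w}"] exI[of _ "{}"]) (auto intro: forest.empty)
  moreover have "n \<le> card W" if "P n" for n
    using that card_mono[OF finW] by (auto simp: P_def)
  ultimately obtain n where "P n" and max: "\<And>m. P m \<Longrightarrow> m \<le> n"
    using GreatestI_nat[of P 1] Greatest_le_nat[of P] by blast
  then obtain S F where S: "w \<in> S" "S \<subseteq> W" "F \<subseteq> edges (induced G S)" "forest G F"
    "Suc (card F) = card S" "card S = n"
    by (auto simp: P_def)
  have "S = W"
  proof (rule ccontr)
    assume "S \<noteq> W"
    then obtain x where x: "x \<in> W" "x \<notin> S"
      using S by blast
    then have "(w, x) \<in> (adjacency G)\<^sup>*"
      using in_quotient_imp_in_rel[OF equiv_connectedness W, of w x] w by (auto simp: connectedness_def)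
    \<comment> \<open>A walk that starts in \<open>S\<close> at \<open>w\<close> and ends outside
      \<open>S\<close> has a step out of \<open>S\<close>.\<close>
    then have "\<exists>a b. (a, b) \<in> adjacency G \<and> a \<in> S \<and> b \<notin> S"
      using x(2) by (induction) (use S(1) in blast)+
    then obtain a b where ab: "(a, b) \<in> adjacency G" "a \<in> S" "b \<notin> S"
      by blast
    then obtain e where e: "e \<in> edges G" "ends G e = {a, b}"
      by (auto simp: adjacency_def)
    then have "b \<in> verts G" "a \<in> W"
      using G S ab by (auto simp: graph_def)
    then have "(a, b) \<in> connectedness G"
      using ab S WV by (auto simp: connectedness_def)
    then have "b \<in> W"
      using in_quotient_imp_closed[OF equiv_connectedness W] \<open>a \<in> W\<close> by blast
    have bF: "b \<notin> \<Union> (ends G ` F)"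
      using S ab by (auto simp: induced_def)
    then have "forest G (insert e F)"
      using S e ab by (intro forest.insert[of G F e a b]) auto
    moreover have "finite S" "e \<notin> F"
      using S finW bF e finite_subset by auto
    moreover have "finite F"
      by (rule finite_subset[of _ "edges G"]) (use S G in \<open>auto simp: induced_def graph_def\<close>)
    ultimately have "P (Suc n)"
      unfolding P_def using S ab e \<open>b \<in> W\<close>
      by (intro exI[of _ "insert b S"] exI[of _ "insert e F"]) (auto simp: induced_def)
    then show False
      using max by fastforce
  qed
  with S that show thesis
    by blast
qed

lemma exists_spanning_forest:
  assumes G: "graph G"
  obtains F where "F \<subseteq> edges G" "forest G F"
    "\<And>W. W \<in> verts G // connectedness G \<Longrightarrow> Suc (card (F \<inter> edges (induced G W))) = card W"
proof -
  let ?Q = "verts G // connectedness G"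
  have "\<forall>W\<in>?Q. \<exists>F. F \<subseteq> edges (induced G W) \<and> forest G F \<and> Suc (card F) = card W"
    using exists_spanning_tree_of_class[OF G] by metis
  then obtain T where T: "\<And>W. W \<in> ?Q \<Longrightarrow> T W \<subseteq> edges (induced G W)"
    "\<And>W. W \<in> ?Q \<Longrightarrow> forest G (T W)" "\<And>W. W \<in> ?Q \<Longrightarrow> Suc (card (T W)) = card W"
    by metis
  have "finite ?Q"
    using G by (intro finite_quotient) (auto simp: connectedness_def graph_def)
  moreover have "forest G (\<Union> (T ` R))" if "finite R" "R \<subseteq> ?Q" for R
    using that
  proof (induction R rule: finite_induct)
    case (insert W R)
    have "ends G e \<inter> ends G e' = {}" if "W' \<in> R" "e \<in> T W'" "e' \<in> T W" for W' e e'
    proof -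
      have "ends G e \<subseteq> W'" "ends G e' \<subseteq> W" "W' \<noteq> W"
        using T(1)[of W'] T(1)[of W] that insert by (auto simp: induced_def)
      then show ?thesis
        using quotient_disj[OF equiv_connectedness, of W G W'] that insert by blast
    qed
    then have "\<Union> (ends G ` \<Union> (T ` R)) \<inter> \<Union> (ends G ` T W) = {}"
      by fast
    then have "forest G (\<Union> (T ` R) \<union> T W)"
      using insert T(2) by (intro forest_Un) auto
    then show ?case
      by (simp add: Un_commute)
  qed (auto intro: forest.empty)
  ultimately have "forest G (\<Union> (T ` ?Q))"
    by simp
  moreover have "\<Union> (T ` ?Q) \<subseteq> edges G"
    using T(1) by (fastforce simp: induced_def)
  moreover have "\<Union> (T ` ?Q) \<inter> edges (induced G W) = T W" if "W \<in> ?Q" for W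
    using T(1) that connectedness_class_unique[OF G] by blast
  ultimately show thesis
    using that T(3) by simp
qed

section \<open>A forest that almost spans the matroid\<close>

text \<open>Modulo a spanning forest \<open>F\<close>, every component has rank at most one, and the elements outside
  \<open>cl F\<close> fall into parallel classes, because a longer circuit modulo \<open>F\<close> would yield a circuit with
  three components. Two such classes would separate the matroid.\<close>

lemma (in vector_family) exists_almost_spanning_forest:
  assumes G: "graph G"
    and leafless: "\<And>C. circuit (vec_matroid (edges G) \<phi>) C \<Longrightarrow> leafless G C"
    and rank: "\<And>H. H \<in> components G \<Longrightarrow> rank (vec_matroid (edges G) \<phi>) (edges H) \<le> card (verts H)"
    and two: "\<And>C. circuit (vec_matroid (edges G) \<phi>) C \<Longrightarrow> card (components (edge_subgraph G C)) \<le> 2"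
    and conn: "\<And>A B. \<not> separation 1 (vec_matroid (edges G) \<phi>) A B"
  obtains F where "F \<subseteq> edges G" "forest G F"
    "\<phi> ` edges G \<subseteq> vs.span (\<phi> ` F) \<or> (\<exists>g\<in>edges G. \<phi> ` edges G \<subseteq> vs.span (\<phi> ` insert g F))"
proof -
  let ?M = "vec_matroid (edges G) \<phi>"
  let ?Q = "verts G // connectedness G"
  let ?E = "\<lambda>W. edges (induced G W)"
  have fin: "finite (edges G)"
    using G by (simp add: graph_def)
  have M: "matroid ?M"
    by (rule matroid_vec_matroid[OF fin])
  have EW: "?E W \<subseteq> edges G" for W
    by (auto simp: induced_def)
  have in_class: "\<exists>W\<in>?Q. e \<in> ?E W" if "e \<in> edges G" for e
    using connectedness_class_of_edge[OF G that] by blast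
  note uniq = connectedness_class_unique[OF G]
  obtain F where F: "F \<subseteq> edges G" "forest G F"
    and cardF: "\<And>W. W \<in> ?Q \<Longrightarrow> Suc (card (F \<inter> ?E W)) = card W"
    using exists_spanning_forest[OF G] by metis
  have circuit_edges: "C \<subseteq> edges G" if "circuit ?M C" for C
    using that by (simp add: circuit_def)
  have indep_if_no_circuit: "lin_indep \<phi> X" if "X \<subseteq> edges G" "\<And>C. circuit ?M C \<Longrightarrow> \<not> C \<subseteq> X" for X
  proof (rule ccontr)
    assume "\<not> lin_indep \<phi> X"
    then have "X \<subseteq> ground ?M" "\<not> indep ?M X"
      using that(1) by simp_all
    then obtain C where "C \<subseteq> X" "circuit ?M C"
      by (rule obtain_circuit[OF M])
    with that(2) show False
      by blast
  qed
  have not_in_indep: "\<not> C \<subseteq> X" if "circuit ?M C" "lin_indep \<phi> X" "X \<subseteq> edges G" for C X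
  proof
    assume "C \<subseteq> X"
    then have "indep ?M C"
      using that lin_indep_mono by auto
    with that(1) show False
      by (simp add: circuit_def)
  qed
  \<comment> \<open>A circuit that meets a component must use an edge outside \<open>F\<close>
    there: its part in the component is \<open>leafless\<close>, and a forest contains no such set
    but the empty one.\<close>
  have circuit_class: "C \<inter> ?E W = {}" if "circuit ?M C" "W \<in> ?Q" "C \<inter> ?E W \<subseteq> F" for C W
    by (rule forest_leafless[OF F(2) that(3)], rule leafless_Int_class[OF G _ _ that(2)])
      (use circuit_edges leafless that(1) in auto)
  have class_bound: "card I \<le> card W" if "W \<in> ?Q" "I \<subseteq> ?E W" "lin_indep \<phi> I" for W I
  proof -
    have "card I \<le> rank ?M (?E W)"
      using that EW by (intro card_le_rank[OF M]) auto
    also have "\<dots> \<le> card (verts (induced G W))"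
      using that by (intro rank) (auto simp: components_def)
    finally show ?thesis
      by (simp add: induced_def)
  qed
  \<comment> \<open>The tree of the component has one edge less than vertices. One further
    independent element reaches the bound of condition (2), so nothing in the component is left
    unspanned.\<close>
  have class_span: "\<phi> ` ?E W \<subseteq> vs.span (\<phi> ` insert e (F \<inter> ?E W))"
    if W: "W \<in> ?Q" and e: "e \<in> ?E W" "e \<notin> F" and ind: "lin_indep \<phi> (insert e (F \<inter> ?E W))" for W e
  proof -
    let ?I = "insert e (F \<inter> ?E W)"
    have "finite (F \<inter> ?E W)"
      using fin F finite_subset by blast
    then have cardI: "card ?I = card W"
      using e cardF[OF W] by simp
    have "\<phi> f \<in> vs.span (\<phi> ` ?I)" if f: "f \<in> ?E W" for f
    proof (rule ccontr)
      assume *: "\<phi> f \<notin> vs.span (\<phi> ` ?I)"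
      then have "f \<notin> ?I"
        using span_image_base[of f ?I \<phi>] by (rule contrapos_nn)
      then have "lin_indep \<phi> (insert f ?I)"
        using ind * by (simp only: lin_indep_insert simp_thms)
      then have "card (insert f ?I) \<le> card W"
        using W e f by (intro class_bound) auto
      then show False
        using \<open>f \<notin> ?I\<close> \<open>finite (F \<inter> ?E W)\<close> cardI by simp
    qed
    then show ?thesis
      by blast
  qed
  have indF: "lin_indep \<phi> F"
  proof (rule indep_if_no_circuit[OF F(1)])
    fix C assume C: "circuit ?M C"
    show "\<not> C \<subseteq> F"
    proof
      assume "C \<subseteq> F"
      then have "C = {}"
        using forest_leafless[OF F(2)] leafless[OF C] by blast
      with C show False
        by (simp add: circuit_def)
    qed
  qed
  show thesis
  proof (cases "\<phi> ` edges G \<subseteq> vs.span (\<phi> ` F)")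
    case True
    with F that show thesis
      by blast
  next
    case False
    then obtain g where g: "g \<in> edges G" "\<phi> g \<notin> vs.span (\<phi> ` F)"
      by blast
    then have "g \<notin> F"
      using span_image_base[of g F \<phi>] by auto
    let ?Z = "insert g F"
    have indZ: "lin_indep \<phi> ?Z" and ZE: "?Z \<subseteq> edges G"
      using g F indF \<open>g \<notin> F\<close> by (auto simp: lin_indep_insert)
    obtain W1 where W1: "W1 \<in> ?Q" "g \<in> ?E W1"
      using in_class g by blast
    \<comment> \<open>These are the components all of whose edges are loops or parallel to
      \<open>g\<close> after contraction of \<open>F\<close>. The aim is that they are all
      components.\<close>
    define Q' where "Q' = {W \<in> ?Q. \<phi> ` ?E W \<subseteq> vs.span (\<phi> ` ?Z)}"
    define A where "A = \<Union> (?E ` Q')"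
    define B where "B = edges G - A"
    have mem_A: "e \<in> A \<longleftrightarrow> W \<in> Q'" if "W \<in> ?Q" "e \<in> ?E W" for W e
      using that uniq unfolding A_def Q'_def by blast
    have "lin_indep \<phi> (insert g (F \<inter> ?E W1))"
      by (rule lin_indep_mono[OF indZ]) blast
    then have "\<phi> ` ?E W1 \<subseteq> vs.span (\<phi> ` insert g (F \<inter> ?E W1))"
      by (rule class_span[OF W1 \<open>g \<notin> F\<close>])
    also have "\<dots> \<subseteq> vs.span (\<phi> ` ?Z)"
      by (intro span_image_mono) auto
    finally have W1Q: "W1 \<in> Q'"
      using W1 by (simp add: Q'_def)
    have "B = {}"
    proof (rule ccontr)
      assume "B \<noteq> {}"
      let ?IA = "?Z \<inter> A"
      have finAB: "finite A" "finite B" "A \<subseteq> edges G" "B \<subseteq> edges G"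
        using fin EW finite_subset[of A "edges G"] by (auto simp: A_def B_def)
      have spanA: "\<phi> ` A \<subseteq> vs.span (\<phi> ` ?IA)"
      proof (rule image_subsetI)
        fix e assume e: "e \<in> A"
        then obtain W where W: "W \<in> ?Q" "e \<in> ?E W" "W \<in> Q'"
          unfolding A_def Q'_def by blast
        show "\<phi> e \<in> vs.span (\<phi> ` ?IA)"
        proof (cases "e \<in> ?Z")
          case True
          with e show ?thesis
            by (intro span_image_base) simp
        next
          case False
          have "\<phi> e \<in> vs.span (\<phi> ` ?Z)"
            using W unfolding Q'_def by blast
          then obtain C where C: "C \<subseteq> insert e ?Z" "e \<in> C" "circuit ?M C"
            using obtain_circuit_through[OF fin ZE indZ _ False] e finAB by blast
          \<comment> \<open>In a component other than those of \<open>e\<close> and \<open>g\<close>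
            the circuit could only use edges of \<open>F\<close>, hence it does not meet that
            component.\<close>
          have "C - {e} \<subseteq> ?IA"
          proof
            fix d assume d: "d \<in> C - {e}"
            then obtain W' where W': "W' \<in> ?Q" "d \<in> ?E W'"
              using in_class circuit_edges[OF C(3)] by blast
            have "W' = W \<or> W' = W1"
            proof (rule ccontr)
              assume "\<not> ?thesis"
              then have "C \<inter> ?E W' \<subseteq> F"
                using C(1) uniq W W1 W' by blast
              with d W' show False
                using circuit_class[OF C(3) W'(1)] by blast
            qed
            then have "d \<in> A"
              using mem_A[OF W'] W W1Q by blast
            with d C show "d \<in> ?IA"
              by blast
          qed
          then show ?thesis
            using circuit_vec_matroid_span[OF C(3,2)] span_image_mono[of "C - {e}" ?IA \<phi>]
            by (simp only: subset_eq)
        qed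
      qed
      have "lin_indep \<phi> (F \<inter> B)"
        by (rule lin_indep_mono[OF indF]) blast
      then obtain IB where IB: "F \<inter> B \<subseteq> IB" "IB \<subseteq> B" "lin_indep \<phi> IB" "\<phi> ` B \<subseteq> vs.span (\<phi> ` IB)"
        using lin_indep_extend[OF finAB(2), of "F \<inter> B" \<phi>] by blast
      \<comment> \<open>A basis of \<open>A\<close> and a basis of \<open>B\<close> are independent
        together; this makes the two ranks add up to at most the rank of M and yields the
        separation.\<close>
      have indAB: "lin_indep \<phi> (?IA \<union> IB)"
      proof (rule indep_if_no_circuit)
        show "?IA \<union> IB \<subseteq> edges G"
          using IB finAB by blast
        fix C assume C: "circuit ?M C"
        show "\<not> C \<subseteq> ?IA \<union> IB"
        proof
          assume sub: "C \<subseteq> ?IA \<union> IB"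
          have "\<not> C \<subseteq> IB"
            by (rule not_in_indep[OF C IB(3)]) (use IB finAB in blast)
          then obtain a where a: "a \<in> C" "a \<in> ?IA"
            using sub by blast
          then obtain Wa where Wa: "Wa \<in> ?Q" "a \<in> ?E Wa"
            using in_class ZE by blast
          then have "Wa \<in> Q'"
            using mem_A a by blast
          \<comment> \<open>In a component inside \<open>A\<close>, the only available element
            outside \<open>F\<close> is \<open>g\<close>.\<close>
          have "g \<in> C"
          proof (rule ccontr)
            assume "g \<notin> C"
            have "C \<inter> ?E Wa \<subseteq> A"
              using mem_A Wa \<open>Wa \<in> Q'\<close> by blast
            then have "C \<inter> ?E Wa \<subseteq> F"
              using sub \<open>g \<notin> C\<close> IB unfolding B_def by blast
            then show False
              using circuit_class[OF C Wa(1)] a Wa by blast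
          qed
          have "lin_indep \<phi> ?IA"
            by (rule lin_indep_mono[OF indZ]) blast
          then have "\<not> C \<subseteq> ?IA"
            by (rule not_in_indep[OF C]) (use ZE in blast)
          then obtain b where b: "b \<in> C" "b \<in> IB"
            using sub by blast
          then have "b \<in> B"
            using IB by blast
          then obtain W where W: "W \<in> ?Q" "b \<in> ?E W"
            using in_class finAB by blast
          then have "W \<notin> Q'"
            using mem_A \<open>b \<in> B\<close> unfolding B_def by blast
          then have "W \<noteq> W1"
            using W1Q by blast
          \<comment> \<open>The elements \<open>b\<close> and \<open>g\<close> already account for
            two components, and condition (4) allows no third one.\<close>
          have only: "W' = W \<or> W' = W1" if "W' \<in> ?Q" "d \<in> ?E W'" "d \<in> C" for W' d
          proof (rule ccontr)
            assume "\<not> ?thesis"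
            then have "3 \<le> card (components (edge_subgraph G C))"
              using that W W1 b \<open>g \<in> C\<close> \<open>W \<noteq> W1\<close>
              by (intro components_ge_3[OF G circuit_edges[OF C], of W' W W1]) auto
            with two[OF C] show False
              by simp
          qed
          have EWB: "?E W \<subseteq> B"
            using mem_A W(1) \<open>W \<notin> Q'\<close> EW unfolding B_def by blast
          have "\<not> C \<inter> ?E W \<subseteq> F"
            using circuit_class[OF C W(1)] b W by blast
          then obtain f where f: "f \<in> C" "f \<in> ?E W" "f \<notin> F"
            by blast
          then have "f \<in> IB"
            using sub EWB unfolding B_def by blast
          have FW: "F \<inter> ?E W \<subseteq> IB"
            using IB EWB by blast
          have finIB: "finite (IB \<inter> ?E W)"
            using finAB IB finite_subset by blast
          have ind_f: "lin_indep \<phi> (insert f (F \<inter> ?E W))"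
            by (rule lin_indep_mono[OF IB(3)]) (use FW \<open>f \<in> IB\<close> in blast)
          have "lin_indep \<phi> (IB \<inter> ?E W)"
            by (rule lin_indep_mono[OF IB(3)]) blast
          then have "card (IB \<inter> ?E W) \<le> card W"
            using class_bound[OF W(1), of "IB \<inter> ?E W"] by blast
          moreover have "finite (F \<inter> ?E W)"
            using finIB FW finite_subset[of "F \<inter> ?E W" "IB \<inter> ?E W"] by blast
          then have "card (insert f (F \<inter> ?E W)) = card W"
            using f cardF[OF W(1)] by simp
          \<comment> \<open>By the rank bound, \<open>IB\<close> has room for only one element
            beyond the tree of \<open>W\<close>, so \<open>f\<close> is that element.\<close>
          ultimately have IBW: "insert f (F \<inter> ?E W) = IB \<inter> ?E W"
            using FW f \<open>f \<in> IB\<close> by (intro card_seteq[OF finIB]) auto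
          \<comment> \<open>Hence the circuit puts the vector of \<open>f\<close> into the span of
            \<open>?Z\<close>. Together with its tree, \<open>f\<close> spans all of
            \<open>W\<close>, which would then belong to \<open>Q'\<close>.\<close>
          have "C - {f} \<subseteq> ?Z"
          proof
            fix d assume d: "d \<in> C - {f}"
            show "d \<in> ?Z"
            proof (cases "d \<in> ?IA")
              case False
              then have "d \<in> IB"
                using d sub by blast
              then obtain W' where W': "W' \<in> ?Q" "d \<in> ?E W'"
                using in_class IB finAB by blast
              have "W' \<noteq> W1"
                using mem_A[OF W'] W1Q \<open>d \<in> IB\<close> IB unfolding B_def by blast
              then have "d \<in> IB \<inter> ?E W"
                using only[OF W'] d W' \<open>d \<in> IB\<close> by blast
              then show ?thesis
                using IBW d by blast
            qed blast
          qed
          then have "\<phi> f \<in> vs.span (\<phi> ` ?Z)"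
            using circuit_vec_matroid_span[OF C f(1)] span_image_mono[of "C - {f}" ?Z \<phi>]
            by (simp only: subset_eq)
          then have "\<phi> ` insert f (F \<inter> ?E W) \<subseteq> vs.span (\<phi> ` ?Z)"
            using span_image_base[of _ ?Z \<phi>] by (intro image_subsetI) fast
          then have "vs.span (\<phi> ` insert f (F \<inter> ?E W)) \<subseteq> vs.span (\<phi> ` ?Z)"
            by (intro vs.span_minimal) auto
          then have "W \<in> Q'"
            using class_span[OF W(1) f(2,3) ind_f] W unfolding Q'_def by blast
          with \<open>W \<notin> Q'\<close> show False ..
        qed
      qed
      have fin_I: "finite ?IA" "finite IB"
        using finAB IB finite_subset by blast+
      have "rank ?M A + rank ?M B \<le> card ?IA + card IB"
        using spanA IB fin_I by (intro add_mono rank_vec_matroid_le[OF fin]) auto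
      also have "\<dots> = card (?IA \<union> IB)"
        using fin_I IB by (intro card_Un_disjoint[symmetric]) (auto simp: B_def)
      also have "\<dots> \<le> rank ?M (edges G)"
        using indAB finAB IB by (intro card_le_rank[OF M]) auto
      finally have "rank ?M A + rank ?M B < rank ?M (edges G) + 1"
        by simp
      moreover have "g \<in> A"
        using mem_A W1 W1Q by blast
      then have "1 \<le> card A" "1 \<le> card B"
        using finAB \<open>B \<noteq> {}\<close> by (auto simp: Suc_le_eq card_gt_0_iff)
      moreover have "A \<union> B = edges G" "A \<inter> B = {}"
        using finAB by (auto simp: B_def)
      ultimately have "separation 1 ?M A B"
        by (simp add: separation_def)
      with conn show False ..
    qed
    have "\<phi> ` edges G \<subseteq> vs.span (\<phi> ` ?Z)"
    proof (rule image_subsetI)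
      fix e assume "e \<in> edges G"
      then have "e \<in> A"
        using \<open>B = {}\<close> unfolding B_def by blast
      then show "\<phi> e \<in> vs.span (\<phi> ` ?Z)"
        unfolding A_def Q'_def by blast
    qed
    with F g that show thesis
      by blast
  qed
qed

section \<open>Vectors indexed by the vertices\<close>

definition fscale :: "'k::field \<Rightarrow> ('v \<Rightarrow> 'k) \<Rightarrow> 'v \<Rightarrow> 'k" where
  "fscale a f = (\<lambda>i. a * f i)"

lemma fscale_apply [simp]: "fscale a f i = a * f i"
  by (simp add: fscale_def)

interpretation vec: vector_family fscale
  by unfold_locales (auto simp: fscale_def fun_eq_iff algebra_simps)

lemma sum_fun_apply: "(\<Sum>x\<in>X. f x) i = (\<Sum>x\<in>X. f x i)"
  for f :: "'a \<Rightarrow> 'i \<Rightarrow> 'b::comm_monoid_add"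
  by (induction X rule: infinite_finite_induct) auto

text \<open>Weighted incidence matrices of \<open>G\<close>, one column per edge. The two entries of
  a link are nonzero but otherwise arbitrary; the entry of a loop may be any scalar, zero
  included.\<close>

definition incidence_family :: "('v, 'e) graph \<Rightarrow> ('e \<Rightarrow> 'v \<Rightarrow> 'k::field) \<Rightarrow> bool" where
  "incidence_family G \<Psi> \<longleftrightarrow>
    (\<forall>e\<in>edges G. \<forall>v. (v \<notin> ends G e \<longrightarrow> \<Psi> e v = 0) \<and>
      (v \<in> ends G e \<and> card (ends G e) = 2 \<longrightarrow> \<Psi> e v \<noteq> 0))"

text \<open>If a link were the only edge of the support at one of its ends, the coordinate of the
  relation at that end would consist of a single nonzero term.\<close>

lemma support_leafless:
  assumes inc: "incidence_family G \<Psi>" and D: "D \<subseteq> edges G" "finite D"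
    and c: "\<And>e. e \<in> D \<Longrightarrow> c e \<noteq> 0" "(\<Sum>e\<in>D. fscale (c e) (\<Psi> e)) = 0"
  shows "leafless G D"
  unfolding leafless_def
proof (intro ballI impI, rule ccontr)
  fix e v
  assume e: "e \<in> D" "v \<in> ends G e" "card (ends G e) = 2"
    and no: "\<not> (\<exists>e'\<in>D - {e}. v \<in> ends G e')"
  have "0 = (\<Sum>e'\<in>D. c e' * \<Psi> e' v)"
    using fun_cong[OF c(2), of v] by (simp add: sum_fun_apply)
  also have "\<dots> = c e * \<Psi> e v + (\<Sum>e'\<in>D - {e}. c e' * \<Psi> e' v)"
    using D e by (simp add: sum.remove)
  also have "(\<Sum>e'\<in>D - {e}. c e' * \<Psi> e' v) = 0"
    using no inc D by (intro sum.neutral) (auto simp: incidence_family_def)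
  finally show False
    using e c(1) inc D by (auto simp: incidence_family_def)
qed

text \<open>The support of a nontrivial relation would be a nonempty \<open>leafless\<close> set.
  For a forest this gives independence whatever the weights are.\<close>

lemma lin_indep_if_no_leafless:
  assumes G: "graph G" and inc: "incidence_family G \<Psi>" and X: "X \<subseteq> edges G"
    and no: "\<And>D. D \<subseteq> X \<Longrightarrow> leafless G D \<Longrightarrow> D = {}"
  shows "vec.lin_indep \<Psi> X"
proof -
  have fin: "finite X"
    using G X finite_subset by (auto simp: graph_def)
  have "c e = 0" if c: "(\<Sum>x\<in>X. fscale (c x) (\<Psi> x)) = 0" and e: "e \<in> X" for c e
  proof -
    let ?D = "{x \<in> X. c x \<noteq> 0}"
    have "(\<Sum>x\<in>?D. fscale (c x) (\<Psi> x)) = (\<Sum>x\<in>X. fscale (c x) (\<Psi> x))"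
      by (rule sum.mono_neutral_left) (use fin in auto)
    then have "leafless G ?D"
      using c X fin by (intro support_leafless[OF inc]) auto
    then have "?D = {}"
      by (intro no) auto
    with e show ?thesis
      by blast
  qed
  then show ?thesis
    using fin by (auto simp: vec.lin_indep_iff)
qed

text \<open>Each edge of the forest imposes one equation on \<open>p\<close>, and its leaf is
  untouched by all earlier equations, so its value can be solved for.\<close>

lemma forest_potential:
  fixes \<Psi> :: "'e \<Rightarrow> 'v \<Rightarrow> 'k::field"
  assumes G: "graph G" and inc: "incidence_family G \<Psi>" and F: "forest G F" "F \<subseteq> edges G"
  obtains p :: "'v \<Rightarrow> 'k" where "\<And>v. p v \<noteq> 0" "\<And>e. e \<in> F \<Longrightarrow> (\<Sum>v\<in>verts G. p v * \<Psi> e v) = 0"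
proof -
  have "\<exists>p :: 'v \<Rightarrow> 'k. (\<forall>v. p v \<noteq> 0) \<and> (\<forall>e\<in>F. (\<Sum>v\<in>verts G. p v * \<Psi> e v) = 0)"
    using F
  proof (induction)
    case empty
    show ?case
      by (intro exI[of _ "\<lambda>_. 1"]) auto
  next
    case (insert X e u v)
    then obtain p :: "'v \<Rightarrow> 'k" where p: "\<forall>v. p v \<noteq> 0" "\<forall>e\<in>X. (\<Sum>v\<in>verts G. p v * \<Psi> e v) = 0"
      by auto
    \<comment> \<open>The value at \<open>v\<close> solves
      \<open>p u * \<Psi> e u + q v * \<Psi> e v = 0\<close>; it is nonzero because both entries of
      a link are.\<close>
    define q where "q = p(v := - p u * \<Psi> e u / \<Psi> e v)"
    have e: "e \<in> edges G" "card (ends G e) = 2"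
      using insert by auto
    then have nz: "\<Psi> e u \<noteq> 0" "\<Psi> e v \<noteq> 0"
      using inc insert by (auto simp: incidence_family_def)
    have "(\<Sum>w\<in>verts G. q w * \<Psi> e' w) = (\<Sum>w\<in>verts G. p w * \<Psi> e' w)" if "e' \<in> X" for e'
    proof (rule sum.cong)
      fix w
      have "\<Psi> e' v = 0"
        using that insert inc by (auto simp: incidence_family_def)
      then show "q w * \<Psi> e' w = p w * \<Psi> e' w"
        by (simp add: q_def)
    qed simp
    moreover have "(\<Sum>w\<in>verts G. q w * \<Psi> e w) = (\<Sum>w\<in>{u, v}. q w * \<Psi> e w)"
      using G e inc insert.hyps(2)
      by (intro sum.mono_neutral_right) (auto simp: graph_def incidence_family_def)
    then have "(\<Sum>w\<in>verts G. q w * \<Psi> e w) = 0"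
      using \<open>u \<noteq> v\<close> nz by (simp add: q_def)
    moreover have "q w \<noteq> 0" for w
      using p nz by (simp add: q_def)
    ultimately show ?case
      using p by (intro exI[of _ q]) auto
  qed
  with that show thesis
    by blast
qed

text \<open>The vectors of a cycle are supported on as many coordinates as the cycle has edges, and
  they lie in the hyperplane orthogonal to \<open>p\<close>. So they span a space of smaller
  dimension than their number.\<close>

lemma cycle_dependent:
  fixes \<Psi> :: "'e \<Rightarrow> 'v \<Rightarrow> 'k::field"
  assumes G: "graph G" and inc: "incidence_family G \<Psi>" and C: "cycle G C"
    and p: "\<And>v. p v \<noteq> 0" "\<And>e. e \<in> edges G \<Longrightarrow> (\<Sum>v\<in>verts G. p v * \<Psi> e v) = 0"
  shows "\<not> vec.lin_indep \<Psi> C"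
proof
  assume ind: "vec.lin_indep \<Psi> C"
  obtain S where S: "finite S" "S \<noteq> {}" "card S = card C" "finite C" "\<And>e. e \<in> C \<Longrightarrow> ends G e \<subseteq> S"
    using cycle_card[OF C] by metis
  then obtain s where s: "s \<in> S"
    by blast
  \<comment> \<open>With unit vectors written as u, the vector \<open>d v\<close> is u_v / p_v - u_s
    / p_s. For \<open>v\<close> in \<open>S - {s}\<close> these form a basis of the hyperplane
    orthogonal to \<open>p\<close> in the coordinates \<open>S\<close>.\<close>
  define d :: "'v \<Rightarrow> 'v \<Rightarrow> 'k" where
    "d v w = (if w = v then 1 / p v else if w = s then - 1 / p s else 0)" for v w
  let ?T = "S - {s}"
  have "\<Psi> e \<in> vec.vs.span (d ` ?T)" if e: "e \<in> C" for e
  proof -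
    have eG: "e \<in> edges G" "ends G e \<subseteq> verts G"
      using e C G by (auto simp: cycle_def graph_def)
    have zero: "\<Psi> e w = 0" if "w \<notin> S" for w
      using inc eG S(5)[OF e] that by (auto simp: incidence_family_def)
    have "(\<Sum>v\<in>S. p v * \<Psi> e v) = (\<Sum>v\<in>ends G e. p v * \<Psi> e v)"
      using inc eG S e by (intro sum.mono_neutral_right) (auto simp: incidence_family_def)
    also have "\<dots> = (\<Sum>v\<in>verts G. p v * \<Psi> e v)"
      using inc eG G by (intro sum.mono_neutral_left) (auto simp: incidence_family_def graph_def)
    also have "\<dots> = 0"
      using p eG by blast
    finally have sum0: "p s * \<Psi> e s + (\<Sum>v\<in>?T. p v * \<Psi> e v) = 0"
      using S s by (simp add: sum.remove)
    have "\<Psi> e = (\<Sum>v\<in>?T. fscale (p v * \<Psi> e v) (d v))"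
    proof
      fix w
      have "(\<Sum>v\<in>?T. p v * \<Psi> e v * d v w) = \<Psi> e w"
      proof (cases "w = s")
        case True
        have "(\<Sum>v\<in>?T. p v * \<Psi> e v * d v w) = (\<Sum>v\<in>?T. p v * \<Psi> e v) * (- 1 / p s)"
          unfolding sum_distrib_right by (rule sum.cong) (use True in \<open>auto simp: d_def\<close>)
        also have "(\<Sum>v\<in>?T. p v * \<Psi> e v) = - (p s * \<Psi> e s)"
          using sum0 by (simp add: eq_neg_iff_add_eq_0 add.commute)
        finally show ?thesis
          using True p(1)[of s] by simp
      next
        case False
        then have "(\<Sum>v\<in>?T. p v * \<Psi> e v * d v w) = (\<Sum>v\<in>?T. if v = w then \<Psi> e w else 0)"
          by (intro sum.cong) (use p(1) in \<open>auto simp: d_def\<close>)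
        then show ?thesis
          using False S(1) zero[of w] by (simp add: sum.delta)
      qed
      then show "\<Psi> e w = (\<Sum>v\<in>?T. fscale (p v * \<Psi> e v) (d v)) w"
        by (simp add: sum_fun_apply)
    qed
    also have "\<dots> \<in> vec.vs.span (d ` ?T)"
      by (intro vec.vs.span_sum vec.vs.span_scale vec.vs.span_base) auto
    finally show ?thesis .
  qed
  then have "card C \<le> card ?T"
    using S by (intro vec.lin_indep_card_le[OF ind, of ?T d]) auto
  moreover have "card ?T < card S"
    using S s by (meson card_Diff1_less)
  ultimately show False
    using S by simp
qed

text \<open>A dependent set contains the support of a relation, which is \<open>leafless\<close> and
  thus contains a cycle. The relation with coefficients \<open>p\<close> is what makes every cycle
  dependent; for general weights some cycles may be independent.\<close>

lemma cycle_matroid_eq_vec_matroid: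
  assumes G: "graph G" and inc: "incidence_family G \<Psi>"
    and p: "\<And>v. p v \<noteq> 0" "\<And>e. e \<in> edges G \<Longrightarrow> (\<Sum>v\<in>verts G. p v * \<Psi> e v) = 0"
  shows "cycle_matroid G = vec.vec_matroid (edges G) \<Psi>"
proof -
  have "(\<exists>C\<subseteq>X. cycle G C) \<longleftrightarrow> \<not> vec.lin_indep \<Psi> X" if X: "X \<subseteq> edges G" for X
  proof
    assume "\<exists>C\<subseteq>X. cycle G C"
    then show "\<not> vec.lin_indep \<Psi> X"
      using cycle_dependent[OF G inc _ p] vec.lin_indep_mono by blast
  next
    assume "\<not> vec.lin_indep \<Psi> X"
    then obtain D where D: "D \<subseteq> X" "leafless G D" "D \<noteq> {}"
      using lin_indep_if_no_leafless[OF G inc X] by blast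
    obtain C where "C \<subseteq> D" "cycle G C"
      by (rule leafless_contains_cycle[OF G, of D]) (use D X in auto)
    with D show "\<exists>C\<subseteq>X. cycle G C"
      by blast
  qed
  then have "(\<lambda>X. X \<subseteq> edges G \<and> \<not> (\<exists>C\<subseteq>X. cycle G C)) = (\<lambda>X. X \<subseteq> edges G \<and> vec.lin_indep \<Psi> X)"
    by meson
  then show ?thesis
    by (simp add: cycle_matroid_def vec.vec_matroid_def)
qed

section \<open>Representations\<close>

lemma fls_const_mult_sum_nth:
  "fls_nth (\<Sum>e\<in>X. c e * fls_const (a e)) n = (\<Sum>e\<in>X. fls_nth (c e) n * a e)"
  for a :: "'e \<Rightarrow> 'k::field"
  by (simp add: fls_nth_sum fls_mult_const_nth)

text \<open>Laurent series over \<open>'k\<close> form an infinite extension field, and a linear relation with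
  coefficients in it is a relation over \<open>'k\<close> in each degree.\<close>

lemma representable_over_fls:
  assumes "representable_over TYPE('k::field) M"
  shows "representable_over TYPE('k fls) M"
proof -
  obtain m :: nat and A :: "nat \<Rightarrow> _ \<Rightarrow> 'k" where A: "\<And>X. X \<subseteq> ground M \<Longrightarrow> indep M X \<longleftrightarrow>
      (\<forall>c. (\<forall>i<m. (\<Sum>e\<in>X. c e * A i e) = 0) \<longrightarrow> (\<forall>e\<in>X. c e = 0))"
    using assms unfolding representable_over_def by blast
  have "(\<forall>c. (\<forall>i<m. (\<Sum>e\<in>X. c e * fls_const (A i e)) = 0) \<longrightarrow> (\<forall>e\<in>X. c e = 0)) \<longleftrightarrow>
      (\<forall>c. (\<forall>i<m. (\<Sum>e\<in>X. c e * A i e) = 0) \<longrightarrow> (\<forall>e\<in>X. c e = 0))" (is "?L \<longleftrightarrow> ?R") for X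
  proof
    assume L: ?L
    show ?R
    proof (intro allI impI)
      fix c assume c: "\<forall>i<m. (\<Sum>e\<in>X. c e * A i e) = 0"
      have "(\<Sum>e\<in>X. fls_const (c e) * fls_const (A i e)) = fls_const (\<Sum>e\<in>X. c e * A i e)" for i
      proof (rule fls_eqI)
        fix n :: int
        show "fls_nth (\<Sum>e\<in>X. fls_const (c e) * fls_const (A i e)) n =
          fls_nth (fls_const (\<Sum>e\<in>X. c e * A i e)) n"
          unfolding fls_const_mult_sum_nth by simp
      qed
      then have "(\<Sum>e\<in>X. fls_const (c e) * fls_const (A i e)) = 0" if "i < m" for i
        using c that by (simp only: fls_const_0)
      then have "\<forall>e\<in>X. fls_const (c e) = 0"
        using spec[OF L, of "\<lambda>e. fls_const (c e)"] by blast
      then show "\<forall>e\<in>X. c e = 0"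
        by simp
    qed
  next
    assume R: ?R
    show ?L
    proof (intro allI impI)
      fix c :: "_ \<Rightarrow> 'k fls" assume c: "\<forall>i<m. (\<Sum>e\<in>X. c e * fls_const (A i e)) = 0"
      have "(\<Sum>e\<in>X. fls_nth (c e) n * A i e) = 0" if "i < m" for i n
        using c that fls_const_mult_sum_nth[of c "A i" X n] by simp
      then have "\<forall>e\<in>X. fls_nth (c e) n = 0" for n
        using spec[OF R, of "\<lambda>e. fls_nth (c e) n"] by blast
      then show "\<forall>e\<in>X. c e = 0"
        by (auto intro: fls_eqI)
    qed
  qed
  then show ?thesis
    unfolding representable_over_def
    by (intro exI[of _ m] exI[of _ "\<lambda>i e. fls_const (A i e)"]) (simp add: A)
qed

lemma infinite_UNIV_fls: "infinite (UNIV :: 'k::field fls set)"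
proof
  assume "finite (UNIV :: 'k fls set)"
  then have "finite (range (\<lambda>n::nat. fls_X ^ n :: 'k fls))"
    by (rule finite_subset[rotated]) simp
  moreover have "inj (\<lambda>n::nat. fls_X ^ n :: 'k fls)"
  proof (rule injI)
    fix m n :: nat assume "(fls_X ^ m :: 'k fls) = fls_X ^ n"
    then have "fls_subdegree (fls_X ^ m :: 'k fls) = fls_subdegree (fls_X ^ n :: 'k fls)"
      by simp
    then show "m = n"
      by (simp add: fls_subdegree_pow)
  qed
  ultimately show False
    using finite_imageD by blast
qed

lemma representable_over_imp_vec_matroid:
  assumes M: "matroid M" and rep: "representable_over TYPE('k::field) M"
  obtains \<phi> :: "'e \<Rightarrow> nat \<Rightarrow> 'k::field" where "M = vec.vec_matroid (ground M) \<phi>"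
proof -
  obtain m :: nat and A :: "nat \<Rightarrow> 'e \<Rightarrow> 'k" where A: "\<And>X. X \<subseteq> ground M \<Longrightarrow> indep M X \<longleftrightarrow>
      (\<forall>c. (\<forall>i<m. (\<Sum>e\<in>X. c e * A i e) = 0) \<longrightarrow> (\<forall>e\<in>X. c e = 0))"
    using rep unfolding representable_over_def by blast
  \<comment> \<open>Padding with zeros from row \<open>m\<close> on makes the vanishing of a vector
    equivalent to the \<open>m\<close> equations of the matrix.\<close>
  define \<phi> where "\<phi> e i = (if i < m then A i e else 0)" for e i
  have "indep M X \<longleftrightarrow> X \<subseteq> ground M \<and> vec.lin_indep \<phi> X" for X
  proof (cases "X \<subseteq> ground M")
    case True
    then have "finite X"
      using M finite_subset by (auto simp: matroid_def)
    moreover have "(\<Sum>e\<in>X. fscale (c e) (\<phi> e)) = (\<lambda>i. if i < m then \<Sum>e\<in>X. c e * A i e else 0)" for c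
      by (simp add: fun_eq_iff sum_fun_apply \<phi>_def)
    then have "(\<Sum>e\<in>X. fscale (c e) (\<phi> e)) = 0 \<longleftrightarrow> (\<forall>i<m. (\<Sum>e\<in>X. c e * A i e) = 0)" for c
      by (simp add: fun_eq_iff)
    ultimately show ?thesis
      using True by (simp add: A vec.lin_indep_iff)
  qed (use M in \<open>auto simp: matroid_def\<close>)
  then have "indep M = indep (vec.vec_matroid (ground M) \<phi>)"
    by (simp add: fun_eq_iff)
  then have "M = vec.vec_matroid (ground M) \<phi>"
    by (intro matroid.equality) auto
  with that show thesis .
qed

section \<open>An incidence family from a framework\<close>

context vector_family
begin

lemma exists_functional:
  assumes "x \<notin> vs.span S"
  obtains f where "Vector_Spaces.linear scale (*) f" "\<And>y. y \<in> S \<Longrightarrow> f y = 0" "f x \<noteq> 0"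
proof -
  interpret pair: vector_space_pair scale "(*) :: 'k \<Rightarrow> 'k \<Rightarrow> 'k"
    by unfold_locales (auto simp: algebra_simps)
  obtain B where B: "B \<subseteq> S" "vs.independent B" "S \<subseteq> vs.span B"
    using vs.maximal_independent_subset by metis
  have "x \<notin> vs.span B"
    using assms vs.span_mono[OF B(1)] by blast
  then have "vs.independent (insert x B)" and "x \<notin> B"
    using B(2) vs.span_base by (auto simp: vs.independent_insert)
  then obtain f where f: "Vector_Spaces.linear scale (*) f"
    "\<forall>b\<in>insert x B. f b = (if b = x then 1 else 0)"
    using pair.linear_independent_extend[of "insert x B" "\<lambda>b. if b = x then 1 else 0"] by blast
  have "f y = 0" if "y \<in> S" for y
  proof (rule pair.linear_eq_0_on_span[OF f(1)])
    show "y \<in> vs.span B"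
      using that B by blast
    show "f b = 0" if "b \<in> B" for b
      using f(2) \<open>x \<notin> B\<close> that by auto
  qed
  with f that show thesis
    by simp
qed

text \<open>In the pencil f + t g every vector of the finite set excludes at most one scalar t: none
  if g vanishes at it, since then it differs from the new vector x and f is nonzero at it. An
  infinite field has a scalar left over.\<close>

lemma exists_nonvanishing_functional:
  assumes inf: "infinite (UNIV :: 'k set)" and "finite X" "\<And>x. x \<in> X \<Longrightarrow> x \<notin> vs.span S"
  obtains f where "Vector_Spaces.linear scale (*) f" "\<And>y. y \<in> S \<Longrightarrow> f y = 0"
    "\<And>x. x \<in> X \<Longrightarrow> f x \<noteq> 0"
proof -
  interpret pair: vector_space_pair scale "(*) :: 'k \<Rightarrow> 'k \<Rightarrow> 'k"
    by unfold_locales (auto simp: algebra_simps)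
  have "\<exists>f. Vector_Spaces.linear scale (*) f \<and> (\<forall>y\<in>S. f y = 0) \<and> (\<forall>x\<in>X. f x \<noteq> 0)"
    using assms(2,3)
  proof (induction X rule: finite_induct)
    case empty
    show ?case
      using pair.linear_zero by auto
  next
    case (insert x X)
    obtain f where f: "Vector_Spaces.linear scale (*) f" "\<forall>y\<in>S. f y = 0" "\<forall>x\<in>X. f x \<noteq> 0"
      using insert by auto
    obtain g where g: "Vector_Spaces.linear scale (*) g" "\<And>y. y \<in> S \<Longrightarrow> g y = 0" "g x \<noteq> 0"
      using exists_functional[of x S] insert.prems by auto
    have "finite {t. f y + t * g y = 0}" if "y \<in> insert x X" for y
    proof (cases "g y = 0")
      case True
      then show ?thesis
        using that f g by auto
    next
      case False
      then have "{t. f y + t * g y = 0} \<subseteq> {- f y / g y}"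
        by (auto simp: field_simps eq_neg_iff_add_eq_0)
      then show ?thesis
        using finite_subset by blast
    qed
    then have "finite (\<Union>y\<in>insert x X. {t. f y + t * g y = 0})"
      using insert.hyps by blast
    then obtain t where t: "t \<notin> (\<Union>y\<in>insert x X. {t. f y + t * g y = 0})"
      using ex_new_if_finite[OF inf] by blast
    show ?case
    proof (intro exI[of _ "\<lambda>y. f y + t * g y"] conjI ballI)
      show "Vector_Spaces.linear scale (*) (\<lambda>y. f y + t * g y)"
        by (intro pair.linear_compose_add pair.linear_compose_scale_right f g)
      show "f y + t * g y = 0" if "y \<in> S" for y
        using f g that by simp
      show "f y + t * g y \<noteq> 0" if "y \<in> insert x X" for y
        using t that by blast
    qed
  qed
  with that show thesis
    by blast
qed

end

text \<open>The functionals at the vertices are the coordinates of \<open>T\<close>. Vertices and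
  coordinates of \<phi> share the index type, so that \<open>T\<close> maps the space to itself and
  contraction can be expressed by it.\<close>

lemma exists_incidence_map:
  fixes \<phi> :: "'e \<Rightarrow> 'i \<Rightarrow> 'k::field" and G :: "('i, 'e) graph"
  assumes inf: "infinite (UNIV :: 'k set)" and G: "graph G"
    and cl: "\<And>v. v \<in> verts G \<Longrightarrow> cl (vec.vec_matroid (edges G) \<phi>) (edges (delete_vertex G v))
      \<subseteq> edges (delete_vertex G v) \<union> loops G v"
  obtains T where "Vector_Spaces.linear fscale fscale T" "incidence_family G (T \<circ> \<phi>)"
proof -
  have fin: "finite (edges G)"
    using G by (simp add: graph_def)
  have del: "edges (delete_vertex G v) = {e \<in> edges G. v \<notin> ends G e}" for v
    using G by (auto simp: delete_vertex_def induced_def graph_def)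
  have "\<exists>f. Vector_Spaces.linear fscale (*) f \<and> (\<forall>e\<in>edges G. v \<notin> ends G e \<longrightarrow> f (\<phi> e) = 0) \<and>
      (\<forall>e\<in>edges G. v \<in> ends G e \<and> card (ends G e) = 2 \<longrightarrow> f (\<phi> e) \<noteq> 0)" if v: "v \<in> verts G" for v
  proof -
    let ?S = "\<phi> ` {e \<in> edges G. v \<notin> ends G e}"
    let ?X = "\<phi> ` {e \<in> edges G. v \<in> ends G e \<and> card (ends G e) = 2}"
    have "x \<notin> vec.vs.span ?S" if x_in: "x \<in> ?X" for x
    proof
      assume x: "x \<in> vec.vs.span ?S"
      obtain e where e: "x = \<phi> e" "e \<in> edges G" "v \<in> ends G e" "card (ends G e) = 2"
        using x_in by blast
      \<comment> \<open>Condition (3) excludes this: \<open>e\<close> is a link at \<open>v\<close>,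
        so it neither avoids \<open>v\<close> nor is a loop at \<open>v\<close>.\<close>
      then have "e \<in> cl (vec.vec_matroid (edges G) \<phi>) {e \<in> edges G. v \<notin> ends G e}"
        using x fin by (intro vec.span_imp_mem_cl) auto
      then show False
        using cl[OF v] e by (auto simp: del loops_def)
    qed
    then obtain f where "Vector_Spaces.linear fscale (*) f" "\<And>y. y \<in> ?S \<Longrightarrow> f y = 0"
      "\<And>x. x \<in> ?X \<Longrightarrow> f x \<noteq> 0"
      using vec.exists_nonvanishing_functional[OF inf, of ?X ?S] fin by auto
    then show ?thesis
      by (intro exI[of _ f]) auto
  qed
  then obtain f where f: "\<And>v. v \<in> verts G \<Longrightarrow> Vector_Spaces.linear fscale (*) (f v)"
    "\<And>v e. v \<in> verts G \<Longrightarrow> e \<in> edges G \<Longrightarrow> v \<notin> ends G e \<Longrightarrow> f v (\<phi> e) = 0"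
    "\<And>v e. v \<in> verts G \<Longrightarrow> e \<in> edges G \<Longrightarrow> v \<in> ends G e \<Longrightarrow> card (ends G e) = 2 \<Longrightarrow> f v (\<phi> e) \<noteq> 0"
    by metis
  define T where "T x v = (if v \<in> verts G then f v x else 0)" for x v
  have "f v (x + y) = f v x + f v y" "f v (fscale a x) = a * f v x" if "v \<in> verts G" for v a x y
    using f(1)[OF that] by (auto simp: Vector_Spaces.linear_iff)
  then have "Vector_Spaces.linear fscale fscale T"
    unfolding Vector_Spaces.linear_iff
    using vec.vs.vector_space_axioms by (auto simp: T_def fun_eq_iff)
  moreover have "incidence_family G (T \<circ> \<phi>)"
    using f G by (auto simp: incidence_family_def T_def graph_def)
  ultimately show thesis
    using that by blast
qed

section \<open>Extending the matroid\<close>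

context vector_family
begin

lemma lin_indep_image:
  assumes "inj h"
  shows "lin_indep \<phi> (h ` X) \<longleftrightarrow> lin_indep (\<phi> \<circ> h) X"
  using assms by (auto simp: lin_indep_def image_comp comp_inj_on_iff inj_on_subset
      dest: inj_on_imageI)

lemma relabel_vec_matroid:
  assumes "inj h"
  shows "relabel h (vec_matroid E (\<phi> \<circ> h)) = vec_matroid (h ` E) \<phi>"
proof -
  have "(\<exists>Y. Y \<subseteq> E \<and> lin_indep (\<phi> \<circ> h) Y \<and> X = h ` Y) \<longleftrightarrow> X \<subseteq> h ` E \<and> lin_indep \<phi> X" for X
    using assms by (auto simp: lin_indep_image subset_image_iff)
  then show ?thesis
    by (simp add: relabel_def vec_matroid_def)
qed

lemma delete_vec_matroid: "delete (vec_matroid E \<phi>) T = vec_matroid (E - T) \<phi>"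
  by (auto simp: delete_def vec_matroid_def fun_eq_iff)

text \<open>Contraction of \<open>x\<close> is the quotient by the line through its vector. On the
  span of the family, \<open>T\<close> has exactly this line as its kernel and therefore realizes
  the quotient.\<close>

lemma contract_vec_matroid:
  assumes fin: "finite E" and x: "x \<in> E" "\<phi> x \<noteq> 0"
    and T: "Vector_Spaces.linear scale scale T" "T (\<phi> x) = 0"
    and ker: "\<And>y. y \<in> vs.span (\<phi> ` E) \<Longrightarrow> T y = 0 \<Longrightarrow> y \<in> vs.span {\<phi> x}"
  shows "contract (vec_matroid E \<phi>) {x} = vec_matroid (E - {x}) (T \<circ> \<phi>)"
proof -
  interpret T: Vector_Spaces.linear scale scale T
    by (rule T(1))
  let ?M = "vec_matroid E \<phi>"
  have M: "matroid ?M"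
    by (rule matroid_vec_matroid[OF fin])
  have rank_eq: "rank ?M Y = card Y \<longleftrightarrow> lin_indep \<phi> Y" if Y: "Y \<subseteq> E" for Y
  proof
    have finY: "finite Y"
      using fin Y finite_subset by blast
    assume "rank ?M Y = card Y"
    then obtain I where "I \<subseteq> Y" "indep ?M I" "card I = card Y"
      using obtain_rank[OF M, of Y] by metis
    then show "lin_indep \<phi> Y"
      using card_subset_eq[OF finY] by auto
  next
    assume "lin_indep \<phi> Y"
    then have "card Y \<le> rank ?M Y"
      using Y by (intro card_le_rank[OF M]) auto
    moreover have "rank ?M Y \<le> card Y"
      using fin Y finite_subset by (intro rank_vec_matroid_le) (auto intro: vs.span_base)
    ultimately show "rank ?M Y = card Y"
      by simp
  qed
  have "lin_indep \<phi> {x}"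
    using x lin_indep_insert[of x "{}" \<phi>] by simp
  then have rank1: "rank ?M {x} = 1"
    using rank_eq[of "{x}"] x by simp
  have "lin_indep \<phi> (insert x X) \<longleftrightarrow> lin_indep (T \<circ> \<phi>) X" if X: "X \<subseteq> E - {x}" for X
  proof -
    have finX: "finite X" and "x \<notin> X"
      using X fin finite_subset by blast+
    have Tsum: "T (\<Sum>e\<in>X. scale (c e) (\<phi> e)) = (\<Sum>e\<in>X. scale (c e) ((T \<circ> \<phi>) e))" for c
      by (simp add: T.sum T.scale)
    show ?thesis
    proof
      assume L: "lin_indep \<phi> (insert x X)"
      have "c e = 0" if c: "(\<Sum>e\<in>X. scale (c e) ((T \<circ> \<phi>) e)) = 0" and e: "e \<in> X" for c e
      proof -
        have "(\<Sum>e\<in>X. scale (c e) (\<phi> e)) \<in> vs.span (\<phi> ` E)"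
          using X by (intro vs.span_sum vs.span_scale vs.span_base) auto
        then obtain k where k: "(\<Sum>e\<in>X. scale (c e) (\<phi> e)) = scale k (\<phi> x)"
          using ker Tsum[of c] c by (auto simp: vs.span_singleton)
        \<comment> \<open>The combination lies in the line of \<open>x\<close>, so giving
          \<open>x\<close> the coefficient \<open>- k\<close> completes it to a relation on
          \<open>insert x X\<close>.\<close>
        define c' where "c' = c(x := - k)"
        have "(\<Sum>e\<in>X. scale (c' e) (\<phi> e)) = (\<Sum>e\<in>X. scale (c e) (\<phi> e))"
          by (rule sum.cong) (use \<open>x \<notin> X\<close> in \<open>auto simp: c'_def\<close>)
        then have "(\<Sum>e\<in>insert x X. scale (c' e) (\<phi> e)) = 0"
          using finX \<open>x \<notin> X\<close> k by (simp add: c'_def)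
        then have "c' e = 0"
          using L finX e by (simp add: lin_indep_iff)
        with e \<open>x \<notin> X\<close> show ?thesis
          by (auto simp: c'_def split: if_splits)
      qed
      then show "lin_indep (T \<circ> \<phi>) X"
        using lin_indep_iff[OF finX, of "T \<circ> \<phi>"] by blast
    next
      assume R: "lin_indep (T \<circ> \<phi>) X"
      have "\<forall>e\<in>insert x X. c e = 0" if c: "(\<Sum>e\<in>insert x X. scale (c e) (\<phi> e)) = 0" for c
      proof -
        have eq: "scale (c x) (\<phi> x) + (\<Sum>e\<in>X. scale (c e) (\<phi> e)) = 0"
          using c finX \<open>x \<notin> X\<close> by simp
        then have "T (scale (c x) (\<phi> x)) + T (\<Sum>e\<in>X. scale (c e) (\<phi> e)) = 0"
          by (metis T.add T.zero)
        then have "(\<Sum>e\<in>X. scale (c e) ((T \<circ> \<phi>) e)) = 0"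
          using T(2) unfolding Tsum T.scale by simp
        then have *: "\<forall>e\<in>X. c e = 0"
          using R lin_indep_iff[OF finX, of "T \<circ> \<phi>"] by blast
        then have "scale (c x) (\<phi> x) = 0"
          using eq by simp
        with * x show ?thesis
          by simp
      qed
      then show "lin_indep \<phi> (insert x X)"
        using lin_indep_iff[of "insert x X" \<phi>] finX by blast
    qed
  qed
  then have "X \<subseteq> E - {x} \<and> rank ?M (X \<union> {x}) = card X + rank ?M {x} \<longleftrightarrow>
      X \<subseteq> E - {x} \<and> lin_indep (T \<circ> \<phi>) X" for X
    using rank_eq[of "insert x X"] rank1 x finite_subset[of X E] fin
    by (auto simp: card_insert_if subset_Diff_insert)
  then show ?thesis
    unfolding contract_def vec_matroid_def[of "E - {x}"] by simp
qed

end

text \<open>A column is a combination of the unit vectors at the ends of its edge, and there are at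
  most two of these. Vertices are natural numbers, so their copies under \<open>Inr\<close> serve as
  the new elements.\<close>

lemma frame_matroid_if_incidence_family:
  fixes \<Psi> :: "'e \<Rightarrow> nat \<Rightarrow> 'k::field"
  assumes G: "graph G" and inc: "incidence_family G \<Psi>"
  shows "frame_matroid (vec.vec_matroid (edges G) \<Psi>)"
proof -
  define unit :: "nat \<Rightarrow> nat \<Rightarrow> 'k" where "unit v i = (if i = v then 1 else 0)" for v i
  define \<Phi> :: "'e + nat \<Rightarrow> nat \<Rightarrow> 'k" where "\<Phi> = case_sum \<Psi> unit"
  let ?V = "Inr ` verts G :: ('e + nat) set" and ?E = "Inl ` edges G :: ('e + nat) set"
  let ?M = "vec.vec_matroid (?E \<union> ?V) \<Phi>"
  have fin: "finite (?E \<union> ?V)" "finite (verts G)"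
    using G by (auto simp: graph_def)
  have comp: "\<Phi> \<circ> Inl = \<Psi>" "\<Phi> \<circ> Inr = unit"
    by (auto simp: \<Phi>_def)
  have span: "\<Psi> e \<in> vec.vs.span (\<Phi> ` Inr ` ends G e)" if e: "e \<in> edges G" for e
  proof -
    have "finite (ends G e)"
      using G e finite_subset[OF _ fin(2)] by (simp add: graph_def)
    then have "(\<Sum>v\<in>ends G e. \<Psi> e v * unit v i) = (if i \<in> ends G e then \<Psi> e i else 0)" for i
      by (simp add: unit_def if_distrib[of "(*) _"] sum.delta cong: if_cong)
    moreover have "\<Psi> e i = (if i \<in> ends G e then \<Psi> e i else 0)" for i
      using inc e by (simp add: incidence_family_def)
    ultimately have "(\<Sum>v\<in>ends G e. \<Psi> e v * unit v i) = \<Psi> e i" for i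
      by simp
    then have "\<Psi> e = (\<Sum>v\<in>ends G e. fscale (\<Psi> e v) (unit v))"
      by (simp add: fun_eq_iff sum_fun_apply)
    also have "\<dots> \<in> vec.vs.span (\<Phi> ` Inr ` ends G e)"
      by (intro vec.vs.span_sum vec.vs.span_scale vec.vs.span_base)
        (auto simp: \<Phi>_def image_image)
    finally show ?thesis .
  qed
  have "vec.lin_indep unit (verts G)"
    unfolding vec.lin_indep_iff[OF fin(2)]
  proof (intro allI impI ballI)
    fix c v assume "(\<Sum>u\<in>verts G. fscale (c u) (unit u)) = 0" "v \<in> verts G"
    then have "(\<Sum>u\<in>verts G. c u * unit u v) = 0"
      by (auto simp: fun_eq_iff sum_fun_apply)
    then show "c v = 0"
      using fin \<open>v \<in> verts G\<close> by (simp add: unit_def if_distrib cong: if_cong)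
  qed
  then have ind: "vec.lin_indep \<Phi> ?V"
    by (simp add: vec.lin_indep_image comp)
  have "X = ?V" if X: "X \<subseteq> ?E \<union> ?V" "vec.lin_indep \<Phi> X" "?V \<subseteq> X" for X
  proof (rule ccontr)
    assume "X \<noteq> ?V"
    then obtain e where e: "e \<in> edges G" "Inl e \<in> X"
      using X by blast
    have "vec.lin_indep \<Phi> (insert (Inl e) ?V)"
      by (rule vec.lin_indep_mono[OF X(2)]) (use e X in blast)
    moreover have "Inl e \<notin> ?V"
      by blast
    ultimately have "\<Phi> (Inl e) \<notin> vec.vs.span (\<Phi> ` ?V)"
      by (simp add: vec.lin_indep_insert)
    moreover have "Inr ` ends G e \<subseteq> ?V"
      using G e by (auto simp: graph_def)
    ultimately show False
      using span[OF e(1)] vec.span_image_mono[of "Inr ` ends G e" ?V \<Phi>] by (auto simp: \<Phi>_def)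
  qed
  then have "basis ?M ?V"
    using ind by (auto simp: basis_def)
  moreover have "\<exists>S\<subseteq>?V. card S \<le> 2 \<and> e \<in> cl ?M S" if "e \<in> ?E \<union> ?V" for e
  proof (cases e)
    case (Inl a)
    then have a: "a \<in> edges G"
      using that by auto
    then have sub: "ends G a \<subseteq> verts G" and "card (ends G a) \<le> 2"
      using G by (auto simp: graph_def)
    then have "card (Inr ` ends G a :: ('e + nat) set) \<le> 2"
      by (simp add: card_image)
    moreover have "e \<in> cl ?M (Inr ` ends G a)"
      using span[OF a] sub that Inl by (intro vec.span_imp_mem_cl[OF fin(1)]) (auto simp: \<Phi>_def)
    ultimately show ?thesis
      using sub by (intro exI[of _ "Inr ` ends G a"]) auto
  next
    case (Inr v)
    then have "e \<in> cl ?M {e}"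
      using that by (intro vec.span_imp_mem_cl[OF fin(1)]) (auto intro: vec.vs.span_base)
    then show ?thesis
      using Inr that by (intro exI[of _ "{e}"]) auto
  qed
  ultimately have "framed_matroid ?M ?V"
    using vec.matroid_vec_matroid[OF fin(1)] by (simp add: framed_matroid_def)
  moreover have "?E \<union> ?V - ?V = ?E"
    by blast
  then have "delete ?M ?V = relabel Inl (vec.vec_matroid (edges G) \<Psi>)"
    using vec.relabel_vec_matroid[of Inl "edges G" \<Phi>] by (simp add: vec.delete_vec_matroid comp)
  ultimately show ?thesis
    unfolding frame_matroid_def by blast
qed

text \<open>The new element of the lift is represented by a vector spanning the kernel of the linear
  map that turns the representation \<open>\<phi>\<close> into an incidence family.\<close>

lemma lifted_graphic_if_kernel:
  fixes \<phi> :: "'e \<Rightarrow> nat \<Rightarrow> 'k::field" and G :: "(nat, 'e) graph"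
  assumes G: "graph G" and T: "Vector_Spaces.linear fscale fscale T"
    and inc: "incidence_family G (T \<circ> \<phi>)"
    and z: "z \<noteq> 0" "T z = 0"
    and ker: "\<And>y. y \<in> vec.vs.span (insert z (\<phi> ` edges G)) \<Longrightarrow> T y = 0 \<Longrightarrow> y \<in> vec.vs.span {z}"
    and p: "\<And>v. p v \<noteq> 0" "\<And>e. e \<in> edges G \<Longrightarrow> (\<Sum>v\<in>verts G. p v * T (\<phi> e) v) = 0"
  shows "lifted_graphic (vec.vec_matroid (edges G) \<phi>)"
proof -
  \<comment> \<open>All elements of the form \<open>Inr n\<close> receive the vector
    \<open>z\<close>, but only \<open>Inr 0\<close> is put into the ground set.\<close>
  define \<Phi> :: "'e + nat \<Rightarrow> nat \<Rightarrow> 'k" where "\<Phi> = case_sum \<phi> (\<lambda>_. z)"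
  let ?E = "Inl ` edges G :: ('e + nat) set" and ?x = "Inr 0 :: 'e + nat"
  let ?M = "vec.vec_matroid (insert ?x ?E) \<Phi>"
  have fin: "finite (insert ?x ?E)"
    using G by (auto simp: graph_def)
  have img: "\<Phi> ` insert ?x ?E = insert z (\<phi> ` edges G)"
    by (auto simp: \<Phi>_def image_iff)
  have diff: "insert ?x ?E - {?x} = ?E"
    by blast
  have \<Phi>_x: "\<Phi> ?x = z"
    by (simp add: \<Phi>_def)
  have "contract ?M {?x} = vec.vec_matroid (insert ?x ?E - {?x}) (T \<circ> \<Phi>)"
  proof (rule vec.contract_vec_matroid[OF fin])
    show "y \<in> vec.vs.span {\<Phi> ?x}" if "y \<in> vec.vs.span (\<Phi> ` insert ?x ?E)" "T y = 0" for y
      using that ker unfolding img \<Phi>_x by blast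
  qed (use z T in \<open>simp_all add: \<Phi>_x\<close>)
  then have contract: "contract ?M {?x} = vec.vec_matroid ?E (T \<circ> \<Phi>)"
    unfolding diff .
  \<comment> \<open>The same graph with its edges renamed by \<open>Inl\<close>, since the
    contraction lives on the sum type. The empty set of ends is a dummy for elements that are not
    edges.\<close>
  define G' :: "(nat, 'e + nat) graph" where
    "G' = \<lparr>verts = verts G, edges = ?E, ends = case_sum (ends G) (\<lambda>_. {})\<rparr>"
  have G': "graph G'"
    using G by (auto simp: graph_def G'_def)
  have "incidence_family G' (T \<circ> \<Phi>)"
    using inc by (auto simp: incidence_family_def G'_def \<Phi>_def)
  then have "cycle_matroid G' = vec.vec_matroid (edges G') (T \<circ> \<Phi>)"
    using p by (intro cycle_matroid_eq_vec_matroid[OF G', of _ p]) (auto simp: G'_def \<Phi>_def)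
  then have "graphic (contract ?M {?x})"
    unfolding graphic_def contract using G' by (intro exI[of _ G']) (simp add: G'_def)
  moreover have "\<Phi> \<circ> Inl = \<phi>"
    by (auto simp: \<Phi>_def)
  then have "delete ?M {?x} = relabel Inl (vec.vec_matroid (edges G) \<phi>)"
    using vec.relabel_vec_matroid[of Inl "edges G" \<Phi>] by (simp add: vec.delete_vec_matroid diff)
  ultimately show ?thesis
    unfolding lifted_graphic_def using vec.matroid_vec_matroid[OF fin, of \<Phi>]
    by (intro exI[of _ ?M] exI[of _ ?x]) simp
qed

theorem theorem1p4:
  fixes M :: "'e matroid"
  assumes "matroid M"
    and "n_connected 3 M"
    and "representable_over TYPE('k::field) M"
    and "quasi_graphic M"
  shows "frame_matroid M \<or> lifted_graphic M"
proof -
  obtain G :: "(nat, 'e) graph" where fw: "framework G M"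
    using assms(4) by (auto simp: quasi_graphic_def)
  then have G: "graph G" and EG: "edges G = ground M"
    by (auto simp: framework_def)
  then have fin: "finite (edges G)"
    by (simp add: graph_def)
  obtain \<phi> :: "'e \<Rightarrow> nat \<Rightarrow> 'k fls" where M: "M = vec.vec_matroid (edges G) \<phi>"
    using representable_over_imp_vec_matroid[OF assms(1) representable_over_fls[OF assms(3)]] EG
    by metis
  obtain T where T: "Vector_Spaces.linear fscale fscale T" and inc: "incidence_family G (T \<circ> \<phi>)"
    using exists_incidence_map[OF infinite_UNIV_fls G, of \<phi>] fw
    unfolding framework_def M by blast
  interpret T: Vector_Spaces.linear fscale fscale T
    by (rule T)
  have T_sum: "T (\<Sum>e\<in>X. fscale (c e) (\<phi> e)) = (\<Sum>e\<in>X. fscale (c e) ((T \<circ> \<phi>) e))" for c X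
    by (simp add: T.sum T.scale)
  \<comment> \<open>\<open>T\<close> maps the relation of a circuit to a relation of the incidence
    family with the same nonzero coefficients.\<close>
  have circuit_leafless: "leafless G C" if C: "circuit (vec.vec_matroid (edges G) \<phi>) C" for C
  proof -
    obtain c where c: "\<And>e. e \<in> C \<Longrightarrow> c e \<noteq> 0" "(\<Sum>e\<in>C. fscale (c e) (\<phi> e)) = 0"
      using vec.circuit_vec_matroid_support[OF fin C] by metis
    then have "(\<Sum>e\<in>C. fscale (c e) ((T \<circ> \<phi>) e)) = 0"
      using T_sum[of c C] by simp
    moreover have "C \<subseteq> edges G"
      using C by (simp add: circuit_def)
    ultimately show ?thesis
      using c(1) fin finite_subset by (intro support_leafless[OF inc]) auto
  qed
  have conn: "\<not> separation 1 (vec.vec_matroid (edges G) \<phi>) A B" for A B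
    using assms(2) by (simp add: n_connected_def M)
  obtain F where F: "F \<subseteq> edges G" "forest G F"
    and span: "\<phi> ` edges G \<subseteq> vec.vs.span (\<phi> ` F) \<or>
      (\<exists>g\<in>edges G. \<phi> ` edges G \<subseteq> vec.vs.span (\<phi> ` insert g F))"
    by (rule vec.exists_almost_spanning_forest[OF G circuit_leafless _ _ conn])
      (use fw in \<open>auto simp: framework_def M\<close>)
  have finF: "finite F"
    using F fin finite_subset by blast
  have TF_indep: "vec.lin_indep (T \<circ> \<phi>) F"
    by (rule lin_indep_if_no_leafless[OF G inc F(1)]) (rule forest_leafless[OF F(2)])
  have inj_F: "y = 0" if y: "y \<in> vec.vs.span (\<phi> ` F)" "T y = 0" for y
  proof -
    have "vec.vs.independent (T ` \<phi> ` F)" "inj_on T (\<phi> ` F)"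
      using TF_indep by (auto simp: vec.lin_indep_def image_comp dest: inj_on_imageI)
    then have "inj_on T (vec.vs.span (\<phi> ` F))"
      by (simp add: T.inj_on_span_iff_independent_image)
    then show ?thesis
      using y vec.vs.span_zero[of "\<phi> ` F"] by (metis T.zero inj_onD)
  qed
  show ?thesis
  \<comment> \<open>Only this direction can fail: a relation among the original vectors is always
    preserved by \<open>T\<close>.\<close>
  proof (cases "\<forall>X\<subseteq>edges G. vec.lin_indep \<phi> X \<longrightarrow> vec.lin_indep (T \<circ> \<phi>) X")
    case True
    moreover have "vec.lin_indep \<phi> X" if "X \<subseteq> edges G" "vec.lin_indep (T \<circ> \<phi>) X" for X
    proof -
      have "finite X"
        using that fin finite_subset by blast
      show ?thesis
        unfolding vec.lin_indep_iff[OF \<open>finite X\<close>]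
      proof (intro allI impI)
        fix c assume "(\<Sum>e\<in>X. fscale (c e) (\<phi> e)) = 0"
        then have "(\<Sum>e\<in>X. fscale (c e) ((T \<circ> \<phi>) e)) = 0"
          using T_sum[of c X] by (simp only: T.zero)
        with that(2) show "\<forall>e\<in>X. c e = 0"
          unfolding vec.lin_indep_iff[OF \<open>finite X\<close>] by blast
      qed
    qed
    ultimately have "M = vec.vec_matroid (edges G) (T \<circ> \<phi>)"
      unfolding M by (intro vec.vec_matroid_cong) blast
    then show ?thesis
      using frame_matroid_if_incidence_family[OF G inc] by simp
  next
    case False
    then obtain X where X: "X \<subseteq> edges G" "vec.lin_indep \<phi> X" "\<not> vec.lin_indep (T \<circ> \<phi>) X"
      by blast
    then have finX: "finite X"
      using fin finite_subset by blast
    obtain c x where c: "(\<Sum>e\<in>X. fscale (c e) ((T \<circ> \<phi>) e)) = 0" "x \<in> X" "c x \<noteq> 0"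
      using X(3) unfolding vec.lin_indep_iff[OF finX] by blast
    \<comment> \<open>The coefficients of a relation created by \<open>T\<close>, applied to the
      original independent vectors, give a nonzero vector in the kernel.\<close>
    define z where "z = (\<Sum>e\<in>X. fscale (c e) (\<phi> e))"
    have "z \<noteq> 0"
      using X(2) c unfolding z_def vec.lin_indep_iff[OF finX] by blast
    have "T z = 0"
      using c T_sum by (simp add: z_def)
    have z_span: "z \<in> vec.vs.span (\<phi> ` edges G)"
      unfolding z_def using X by (intro vec.vs.span_sum vec.vs.span_scale vec.vs.span_base) auto
    have z_notin: "z \<notin> vec.vs.span (\<phi> ` F)"
      using inj_F \<open>z \<noteq> 0\<close> \<open>T z = 0\<close> by blast
    then have "\<not> \<phi> ` edges G \<subseteq> vec.vs.span (\<phi> ` F)"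
      using z_span vec.vs.span_minimal[of "\<phi> ` edges G" "vec.vs.span (\<phi> ` F)"] by auto
    with span obtain g where g: "\<phi> ` edges G \<subseteq> vec.vs.span (insert (\<phi> g) (\<phi> ` F))"
      by auto
    then have "z \<in> vec.vs.span (insert (\<phi> g) (\<phi> ` F))"
      using z_span vec.vs.span_minimal[OF g] by auto
    \<comment> \<open>By exchange, \<open>z\<close> can replace \<open>g\<close> as the element
      needed besides the forest, which splits every vector into a part that \<open>T\<close> kills
      and a part in the span of the forest.\<close>
    then have "\<phi> g \<in> vec.vs.span (insert z (\<phi> ` F))"
      using z_notin by (rule vec.vs.in_span_insert)
    then have "insert (\<phi> g) (\<phi> ` F) \<subseteq> vec.vs.span (insert z (\<phi> ` F))"
      using vec.vs.span_superset[of "insert z (\<phi> ` F)"] by auto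
    then have "vec.vs.span (insert (\<phi> g) (\<phi> ` F)) \<subseteq> vec.vs.span (insert z (\<phi> ` F))"
      by (intro vec.vs.span_minimal) auto
    with g have span_z: "\<phi> ` edges G \<subseteq> vec.vs.span (insert z (\<phi> ` F))"
      by (rule order_trans)
    have decomp: "\<exists>k. y - fscale k z \<in> vec.vs.span (\<phi> ` F)"
      if "y \<in> vec.vs.span (insert z (\<phi> ` F))" for y
      using that vec.vs.span_breakdown_eq by blast
    have "insert z (\<phi> ` edges G) \<subseteq> vec.vs.span (insert z (\<phi> ` F))"
      using span_z vec.vs.span_base[of z "insert z (\<phi> ` F)"] by simp
    then have sub: "vec.vs.span (insert z (\<phi> ` edges G)) \<subseteq> vec.vs.span (insert z (\<phi> ` F))"
      by (intro vec.vs.span_minimal) auto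
    have ker: "y \<in> vec.vs.span {z}"
      if y: "y \<in> vec.vs.span (insert z (\<phi> ` edges G))" "T y = 0" for y
    proof -
      obtain k where k: "y - fscale k z \<in> vec.vs.span (\<phi> ` F)"
        using decomp y sub by blast
      moreover have "T (y - fscale k z) = 0"
        using y \<open>T z = 0\<close> by (simp only: T.diff T.scale vec.vs.scale_zero_right diff_zero)
      ultimately have "y - fscale k z = 0"
        by (rule inj_F)
      then have "y = fscale k z"
        by simp
      then show ?thesis
        by (simp add: vec.vs.span_scale vec.vs.span_base)
    qed
    obtain p where p: "\<And>v. p v \<noteq> 0" "\<And>e. e \<in> F \<Longrightarrow> (\<Sum>v\<in>verts G. p v * (T \<circ> \<phi>) e v) = 0"
      using forest_potential[OF G inc F(2,1)] by metis
    \<comment> \<open>The preimage under \<open>T\<close> of the hyperplane orthogonal to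
      \<open>p\<close>. It contains the vectors of the forest by the choice of \<open>p\<close>; all
      other edges differ from their span by a multiple of \<open>z\<close>, which \<open>T\<close>
      does not see.\<close>
    let ?K = "{y. (\<Sum>v\<in>verts G. p v * T y v) = 0}"
    have "vec.vs.subspace ?K"
      by (rule vec.vs.subspaceI)
        (auto simp: T.add T.scale T.zero distrib_left sum.distrib sum_distrib_left[symmetric]
          mult.left_commute)
    moreover have "\<phi> ` F \<subseteq> ?K"
      using p(2) by auto
    ultimately have FK: "vec.vs.span (\<phi> ` F) \<subseteq> ?K"
      by (intro vec.vs.span_minimal)
    have "(\<Sum>v\<in>verts G. p v * T (\<phi> e) v) = 0" if e: "e \<in> edges G" for e
    proof -
      obtain k where "\<phi> e - fscale k z \<in> vec.vs.span (\<phi> ` F)"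
        using decomp[of "\<phi> e"] e span_z by blast
      then have "(\<Sum>v\<in>verts G. p v * T (\<phi> e - fscale k z) v) = 0"
        using FK by blast
      moreover have "T (\<phi> e - fscale k z) = T (\<phi> e)"
        using \<open>T z = 0\<close> by (simp only: T.diff T.scale vec.vs.scale_zero_right diff_zero)
      ultimately show ?thesis
        by simp
    qed
    then have "lifted_graphic M"
      unfolding M using \<open>z \<noteq> 0\<close> \<open>T z = 0\<close> ker p(1)
      by (intro lifted_graphic_if_kernel[OF G T inc]) auto
    then show ?thesis ..
  qed
qed

end
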